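(* Let $u \in \mathcal{S}'(\mathbb{R})$ be such that $d_{1/2} u \in L^{1}_{od}(\mathbb{R}^2) \subset \mathcal{S}'_{od}(\mathbb{R}^2)$. Then there exists a constant $C \in \mathbb{C}$ such that $u - C \in L^{2}(\mathbb{R})$, together with the estimate $$\| u - C \|_{L^2(\mathbb{R})} \le K\, \| d_{1/2} u \|_{L^{1}_{od}(\mathbb{R}^2)},$$ where $K > 0$ is a constant independent of $u$.
   Context: $\mathcal{S}(\mathbb{R}^m)$ is the Fréchet space of complex-valued Schwartz functions, $\mathcal{S}'(\mathbb{R}^m)$ its topological dual (tempered distributions), and $\langle\cdot,\cdot\rangle$ the bilinear pairing; functions are identified with distributions by integration. $\mathcal{S}_{od}(\mathbb{R}^{2})$ (off-diagonal Schwartz functions) is the set of $G \in \mathcal{S}(\mathbb{R}^{2})$, $G = G(x,y)$ with $x,y\in\mathbb{R}$, such that $G(x,y) = -G(y,x)$ for all $x,y$ and $\partial_x^{\alpha}\partial_y^{\beta} G(z,z) = 0$ for all $z \in \mathbb{R}$ and all $\alpha,\beta \in \mathbb{N}_0$; it carries the subspace topology of $\mathcal{S}(\mathbb{R}^{2})$, and $\mathcal{S}'_{od}(\mathbb{R}^{2})$ is its topological dual. For $G \in \mathcal{S}_{od}(\mathbb{R}^{2})$ set $\operatorname{div}_{1/2} G(x) := \int_{\mathbb{R}} \frac{2G(x,y)}{|x-y|^{1/2}} \frac{dy}{|x-y|}$; this defines a continuous linear map $\mathcal{S}_{od}(\mathbb{R}^{2}) \to \mathcal{S}(\mathbb{R})$.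 For $u \in \mathcal{S}'(\mathbb{R})$ the distributional fractional gradient $d_{1/2}u \in \mathcal{S}'_{od}(\mathbb{R}^{2})$ is defined by $\langle d_{1/2} u, G\rangle := \langle u, \operatorname{div}_{1/2} G\rangle$ for $G \in \mathcal{S}_{od}(\mathbb{R}^{2})$. $L^1_{od}(\mathbb{R}^{2})$ is the space of measurable functions $F$ on $\mathbb{R}^2$ with $F(x,y) = -F(y,x)$ and $\|F\|_{L^1_{od}} := \int_{\mathbb{R}}\int_{\mathbb{R}} |F(x,y)| \frac{dx\,dy}{|x-y|} < \infty$. Such an $F$ is identified with the element of $\mathcal{S}'_{od}(\mathbb{R}^{2})$ given by $\langle F, G\rangle := \int_{\mathbb{R}}\int_{\mathbb{R}} F(x,y) G(x,y) \frac{dx\,dy}{|x-y|}$; "$d_{1/2}u \in L^1_{od}$" means that $d_{1/2}u$ equals such an $F$ in $\mathcal{S}'_{od}(\mathbb{R}^2)$, and then $\|d_{1/2}u\|_{L^1_{od}} := \|F\|_{L^1_{od}}$. *)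

theory Defs
  imports "HOL-Analysis.Analysis"
begin

section \<open>Schwartz functions and tempered distributions\<close>

text \<open>Partial derivatives are indexed by lists of basis vectors instead of multi-indices; on smooth
  functions the order of the list is irrelevant.\<close>

primrec partial_derivs :: "'a::euclidean_space list \<Rightarrow> ('a \<Rightarrow> complex) \<Rightarrow> 'a \<Rightarrow> complex" where
  "partial_derivs [] f = f"
| "partial_derivs (b # bs) f = (\<lambda>x. frechet_derivative (partial_derivs bs f) (at x) b)"

definition smooth :: "('a::euclidean_space \<Rightarrow> complex) \<Rightarrow> bool" where
  "smooth f \<longleftrightarrow> (\<forall>bs. set bs \<subseteq> Basis \<longrightarrow> partial_derivs bs f differentiable_on UNIV)"

definition schwartz :: "('a::euclidean_space \<Rightarrow> complex) set" where
  "schwartz = {f. smooth f \<and>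
     (\<forall>k bs. set bs \<subseteq> Basis \<longrightarrow>
        bdd_above (range (\<lambda>x. (1 + norm x) ^ k * norm (partial_derivs bs f x))))}"

definition schwartz_seminorm ::
    "nat \<Rightarrow> 'a::euclidean_space list \<Rightarrow> ('a \<Rightarrow> complex) \<Rightarrow> real" where
  "schwartz_seminorm k bs f = (SUP x. (1 + norm x) ^ k * norm (partial_derivs bs f x))"

text \<open>The Frechet topology: the seminorm balls form a subbasis.\<close>

definition schwartz_topology :: "('a::euclidean_space \<Rightarrow> complex) topology" where
  "schwartz_topology = topology_generated_by
     {{g \<in> schwartz. schwartz_seminorm k bs (\<lambda>x. g x - f x) < e} | f k bs e.
        f \<in> schwartz \<and> set bs \<subseteq> Basis \<and> e > 0}"

text \<open>Functionals on a space of functions are extensional (they are \<^const>\<open>undefined\<close> off the space), so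
  that equality in the dual is equality of HOL functions.\<close>

definition topological_dual :: "('a \<Rightarrow> complex) topology \<Rightarrow> (('a \<Rightarrow> complex) \<Rightarrow> complex) set" where
  "topological_dual T = {u \<in> extensional (topspace T).
     continuous_map T euclidean u \<and>
     (\<forall>f\<in>topspace T. \<forall>g\<in>topspace T. u (\<lambda>x. f x + g x) = u f + u g) \<and>
     (\<forall>c. \<forall>f\<in>topspace T. u (\<lambda>x. c * f x) = c * u f)}"

abbreviation tempered_distributions :: "(('a::euclidean_space \<Rightarrow> complex) \<Rightarrow> complex) set" where
  "tempered_distributions \<equiv> topological_dual schwartz_topology"

definition fun_distribution :: "('a::euclidean_space \<Rightarrow> complex) \<Rightarrow> ('a \<Rightarrow> complex) \<Rightarrow> complex" where
  "fun_distribution f = (\<lambda>\<phi>\<in>schwartz. LINT x|lebesgue. f x * \<phi> x)"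

lemma topspace_schwartz_topology [simp]:
  "topspace (schwartz_topology :: ('a::euclidean_space \<Rightarrow> complex) topology) = schwartz"
proof -
  have "f \<in> \<Union> {{g \<in> schwartz. schwartz_seminorm k bs (\<lambda>x. g x - f x) < e} | f k bs e.
        f \<in> schwartz \<and> set bs \<subseteq> Basis \<and> e > 0}"
    if f: "f \<in> schwartz" for f :: "'a \<Rightarrow> complex"
  proof -
    let ?e = "max 0 (schwartz_seminorm 0 [] (\<lambda>x. f x - f x)) + 1"
    have "f \<in> {g \<in> schwartz. schwartz_seminorm 0 [] (\<lambda>x. g x - f x) < ?e}"
      using f by auto
    moreover have "set [] \<subseteq> (Basis :: 'a set)" "?e > 0" by auto
    ultimately show ?thesis using f by blast
  qed
  then show ?thesis
    unfolding schwartz_topology_def topology_generated_by_topspace by blast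
qed


section \<open>Off-diagonal functions and the fractional gradient\<close>

definition schwartz_od :: "(real \<times> real \<Rightarrow> complex) set" where
  "schwartz_od = {G \<in> schwartz. (\<forall>x y. G (x, y) = - G (y, x)) \<and>
     (\<forall>z \<alpha> \<beta>. partial_derivs (replicate \<alpha> (1, 0) @ replicate \<beta> (0, 1)) G (z, z) = 0)}"

definition schwartz_od_topology :: "(real \<times> real \<Rightarrow> complex) topology" where
  "schwartz_od_topology = subtopology schwartz_topology schwartz_od"

abbreviation od_distributions :: "((real \<times> real \<Rightarrow> complex) \<Rightarrow> complex) set" where
  "od_distributions \<equiv> topological_dual schwartz_od_topology"

definition div_half :: "(real \<times> real \<Rightarrow> complex) \<Rightarrow> real \<Rightarrow> complex" where
  "div_half G x =
     (LINT y|lebesgue. 2 * G (x, y) / of_real (\<bar>x - y\<bar> powr (1/2)) / of_real \<bar>x - y\<bar>)"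

definition d_half :: "((real \<Rightarrow> complex) \<Rightarrow> complex) \<Rightarrow> (real \<times> real \<Rightarrow> complex) \<Rightarrow> complex" where
  "d_half u = (\<lambda>G\<in>schwartz_od. u (div_half G))"

text \<open>Elements of the Lebesgue spaces below are functions rather than classes modulo null sets.\<close>

definition L1_od :: "(real \<times> real \<Rightarrow> complex) set" where
  "L1_od = {F \<in> borel_measurable lebesgue. (\<forall>x y. F (x, y) = - F (y, x)) \<and>
     integrable lebesgue (\<lambda>(x, y). norm (F (x, y)) / \<bar>x - y\<bar>)}"

definition L1_od_norm :: "(real \<times> real \<Rightarrow> complex) \<Rightarrow> real" where
  "L1_od_norm F = (LINT (x, y)|lebesgue. norm (F (x, y)) / \<bar>x - y\<bar>)"

definition od_distribution ::
    "(real \<times> real \<Rightarrow> complex) \<Rightarrow> (real \<times> real \<Rightarrow> complex) \<Rightarrow> complex" where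
  "od_distribution F =
     (\<lambda>G\<in>schwartz_od. LINT (x, y)|lebesgue. F (x, y) * G (x, y) / of_real \<bar>x - y\<bar>)"

definition L2 :: "(real \<Rightarrow> complex) set" where
  "L2 = {f \<in> borel_measurable lebesgue. integrable lebesgue (\<lambda>x. (norm (f x))\<^sup>2)}"

definition L2_norm :: "(real \<Rightarrow> complex) \<Rightarrow> real" where
  "L2_norm f = sqrt (LINT x|lebesgue. (norm (f x))\<^sup>2)"

end

theory Submission
  imports Defs "HOL-Probability.Sinc_Integral"
begin


text \<open>If \<open>u\<close> were a nice function, the hypothesis would say \<open>F(x, y) =
  (u(x) - u(y)) / |x - y|\<^sup>1\<^sup>/\<^sup>2\<close>, so that the norm of \<open>F\<close> is
  the seminorm of \<open>u\<close> in the fractional Sobolev space of order 1/2 and exponent 1.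
  The theorem is then the Sobolev embedding of that space into \<open>L\<^sup>2\<close> modulo
  constants. The proof first turns \<open>u\<close> into a function and then proves the embedding
  through dyadic averages.

  For Schwartz functions \<open>a\<close> and \<open>b\<close> whose supports lie in two disjoint
  closed half-lines, consider \<open>G(x, y) = |x - y|\<^sup>3\<^sup>/\<^sup>2 (a(x) b(y) - a(y)
  b(x))\<close>. It vanishes near the diagonal, and the power cancels the singular kernel, so the
  fractional divergence of \<open>G\<close> is \<open>2 (a \<integral>b - b \<integral>a)\<close>.
  Put \<open>V(x, y) = F(x, y) / |x - y|\<close>, an integrable function with the norm of
  \<open>F\<close>. Pairing with \<open>G\<close> gives \<open>u(a) \<integral>b - u(b)
  \<integral>a = \<integral>\<integral> V(x, y) |x - y|\<^sup>3\<^sup>/\<^sup>2 a(x) b(y)\<close>,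
  which is the weak form of \<open>u(x) - u(y) = V(x, y) |x - y|\<^sup>3\<^sup>/\<^sup>2\<close>
  (\<open>d_half_weak_difference\<close>). With \<open>b\<close> fixed and \<open>\<integral>b =
  1\<close> this writes \<open>u(a)\<close> as the integral of \<open>a\<close> against an
  explicit function. Two choices of \<open>b\<close> and a smooth partition of unity cover the
  line, so \<open>u\<close> is integration against a function \<open>g\<close>
  (\<open>distribution_eq_function\<close>).

  Let \<open>a\<close> and \<open>b\<close> tend to the indicators of adjacent intervals
  \<open>I\<close> and \<open>J\<close> of length \<open>L\<close>. Then the averages of
  \<open>g\<close> over \<open>I\<close> and \<open>J\<close> differ by at most
  \<open>L\<^sup>-\<^sup>2 (2 L)\<^sup>3\<^sup>/\<^sup>2 \<integral>\<integral>\<^bsub>I \<times>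
  J\<^esub> |V|\<close> (\<open>adjacent_interval_estimate\<close>). For the two halves of a
  dyadic interval of length \<open>2\<^sup>-\<^sup>k\<close> this is a multiple of
  \<open>2\<^sup>k\<^sup>/\<^sup>2 \<integral>\<integral>\<^bsub>I \<times> J\<^esub> |V|\<close>.
  The rectangles \<open>I \<times> J\<close> belonging to different dyadic intervals, of whatever
  generation, are disjoint, so all these masses add up to at most \<open>\<integral>\<integral>
  |V|\<close>. By the Cauchy-Schwarz inequality over the generations \<open>k\<close>, the total
  variation along \<open>k\<close> of the dyadic averages of \<open>g\<close> at \<open>x\<close>
  is, as a function of \<open>x\<close>, in \<open>L\<^sup>2\<close> with norm at most \<open>2
  \<integral>\<integral> |V|\<close> (\<open>variation_L2\<close>). The averages over long
  intervals converge to a constant \<open>C\<close>. Over short intervals they converge almost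
  everywhere to \<open>C + f\<close>, where \<open>|f|\<close> is at most the variation, and
  weakly to \<open>g\<close>. Hence \<open>g - C\<close> and \<open>f\<close> are the same
  distribution (\<open>L2_representative\<close>).\<close>

section \<open>Membership in the Schwartz space\<close>

lemma partial_derivs_snoc:
  "partial_derivs bs (\<lambda>x. frechet_derivative f (at x) b) = partial_derivs (bs @ [b]) f"
  by (induction bs) simp_all

lemma schwartz_differentiable:
  "f \<in> schwartz \<Longrightarrow> f differentiable (at x)"
  by (auto simp: schwartz_def smooth_def differentiable_on_def dest!: spec[of _ "[]"])

lemma schwartz_partial:
  assumes "f \<in> schwartz" "b \<in> Basis"
  shows "(\<lambda>x. frechet_derivative f (at x) b) \<in> schwartz"
  using assms by (simp add: schwartz_def smooth_def partial_derivs_snoc)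

lemma schwartz_decay:
  assumes "f \<in> schwartz"
  shows "bdd_above (range (\<lambda>x. (1 + norm x) ^ k * norm (f x)))"
  using assms by (auto simp: schwartz_def dest!: spec[of _ k] spec[of _ "[]"])

lemma schwartz_decayE:
  assumes "f \<in> schwartz"
  obtains M where "M \<ge> 0" "\<And>x. (1 + norm x) ^ k * norm (f x) \<le> M"
proof -
  obtain M where M: "\<And>x. (1 + norm x) ^ k * norm (f x) \<le> M"
    using schwartz_decay[OF assms, of k] by (auto simp: bdd_above_def)
  show thesis by (rule that[of "max 0 M"]) (auto intro: order_trans[OF M])
qed

text \<open>Derivatives of concrete functions are hard to enumerate, but a class of functions that
  is closed under partial derivatives is easy to write down. Rapid decay of its members is then
  all that remains to be checked.\<close>

lemma schwartz_coinduct: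
  fixes X :: "('a::euclidean_space \<Rightarrow> complex) set"
  assumes diff: "\<And>f x. f \<in> X \<Longrightarrow> f differentiable (at x)"
    and step: "\<And>f b. f \<in> X \<Longrightarrow> b \<in> Basis \<Longrightarrow> (\<lambda>x. frechet_derivative f (at x) b) \<in> X"
    and decay: "\<And>f k. f \<in> X \<Longrightarrow> bdd_above (range (\<lambda>x. (1 + norm x) ^ k * norm (f x)))"
  shows "X \<subseteq> schwartz"
proof
  fix f assume f: "f \<in> X"
  have "partial_derivs bs f \<in> X" if "set bs \<subseteq> Basis" for bs
    using that by (induction bs) (auto intro: f step)
  then show "f \<in> schwartz"
    by (auto simp: schwartz_def smooth_def differentiable_on_def intro!: diff decay)
qed

lemma bdd_above_decay_add:
  fixes f g :: "'a::real_normed_vector \<Rightarrow> complex"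
  assumes "bdd_above (range (\<lambda>x. (1 + norm x) ^ k * norm (f x)))"
    and "bdd_above (range (\<lambda>x. (1 + norm x) ^ k * norm (g x)))"
  shows "bdd_above (range (\<lambda>x. (1 + norm x) ^ k * norm (f x + g x)))"
proof -
  obtain M N where M: "\<And>x. (1 + norm x) ^ k * norm (f x) \<le> M"
    and N: "\<And>x. (1 + norm x) ^ k * norm (g x) \<le> N"
    using assms by (auto simp: bdd_above_def)
  have "(1 + norm x) ^ k * norm (f x + g x) \<le> M + N" for x
  proof -
    have "(1 + norm x) ^ k * norm (f x + g x) \<le> (1 + norm x) ^ k * (norm (f x) + norm (g x))"
      by (intro mult_left_mono norm_triangle_ineq) auto
    also have "\<dots> \<le> M + N" using M[of x] N[of x] by (simp add: distrib_left)
    finally show ?thesis .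
  qed
  then show ?thesis by (auto simp: bdd_above_def)
qed

lemma frechet_derivative_add_apply:
  assumes "f differentiable (at x)" "g differentiable (at x)"
  shows "frechet_derivative (\<lambda>x. f x + g x) (at x) b
    = frechet_derivative f (at x) b + frechet_derivative g (at x) b"
proof -
  have "((\<lambda>x. f x + g x) has_derivative
      (\<lambda>h. frechet_derivative f (at x) h + frechet_derivative g (at x) h)) (at x)"
    using assms by (intro has_derivative_add) (simp_all flip: frechet_derivative_works)
  then show ?thesis by (simp flip: frechet_derivative_at)
qed

lemma frechet_derivative_mult_apply:
  fixes f g :: "'a::real_normed_vector \<Rightarrow> complex"
  assumes "f differentiable (at x)" "g differentiable (at x)"
  shows "frechet_derivative (\<lambda>x. f x * g x) (at x) b
    = f x * frechet_derivative g (at x) b + frechet_derivative f (at x) b * g x"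
proof -
  have "((\<lambda>x. f x * g x) has_derivative
      (\<lambda>h. f x * frechet_derivative g (at x) h + frechet_derivative f (at x) h * g x)) (at x)"
    using assms by (intro has_derivative_mult) (simp_all flip: frechet_derivative_works)
  then show ?thesis by (simp flip: frechet_derivative_at)
qed

text \<open>Multipliers of the Schwartz space; boundedness of all derivatives is enough for the
  cutoff functions below.\<close>

definition bounded_smooth :: "('a::euclidean_space \<Rightarrow> complex) set" where
  "bounded_smooth = {f. smooth f \<and>
     (\<forall>bs. set bs \<subseteq> Basis \<longrightarrow> bdd_above (range (\<lambda>x. norm (partial_derivs bs f x))))}"

lemma schwartz_subset_bounded_smooth: "schwartz \<subseteq> bounded_smooth"
proof
  fix f :: "'a \<Rightarrow> complex" assume f: "f \<in> schwartz"
  have "bdd_above (range (\<lambda>x. (1 + norm x) ^ 0 * norm (partial_derivs bs f x)))"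
    if "set bs \<subseteq> Basis" for bs
    using f that unfolding schwartz_def mem_Collect_eq by (elim conjE allE[of _ 0]) simp
  then show "f \<in> bounded_smooth"
    using f by (simp add: bounded_smooth_def schwartz_def)
qed

lemma bounded_smooth_differentiable:
  "f \<in> bounded_smooth \<Longrightarrow> f differentiable (at x)"
  by (auto simp: bounded_smooth_def smooth_def differentiable_on_def dest!: spec[of _ "[]"])

lemma bounded_smooth_partial:
  assumes "f \<in> bounded_smooth" "b \<in> Basis"
  shows "(\<lambda>x. frechet_derivative f (at x) b) \<in> bounded_smooth"
  using assms by (simp add: bounded_smooth_def smooth_def partial_derivs_snoc)

lemma bounded_smooth_coinduct:
  fixes X :: "('a::euclidean_space \<Rightarrow> complex) set"
  assumes diff: "\<And>f x. f \<in> X \<Longrightarrow> f differentiable (at x)"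
    and step: "\<And>f b. f \<in> X \<Longrightarrow> b \<in> Basis \<Longrightarrow> (\<lambda>x. frechet_derivative f (at x) b) \<in> X"
    and bound: "\<And>f. f \<in> X \<Longrightarrow> bdd_above (range (\<lambda>x. norm (f x)))"
  shows "X \<subseteq> bounded_smooth"
proof
  fix f assume f: "f \<in> X"
  have "partial_derivs bs f \<in> X" if "set bs \<subseteq> Basis" for bs
    using that by (induction bs) (auto intro: f step)
  then show "f \<in> bounded_smooth"
    by (auto simp: bounded_smooth_def smooth_def differentiable_on_def intro!: diff bound)
qed

text \<open>By the product rule, finite sums of products form a class that is closed under
  derivatives, to which coinduction applies.\<close>

inductive_set schwartz_products :: "('a::euclidean_space \<Rightarrow> complex) set" where
  prod: "f \<in> schwartz \<Longrightarrow> m \<in> bounded_smooth \<Longrightarrow> (\<lambda>x. f x * m x) \<in> schwartz_products"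
| add: "f \<in> schwartz_products \<Longrightarrow> g \<in> schwartz_products \<Longrightarrow> (\<lambda>x. f x + g x) \<in> schwartz_products"

lemma schwartz_mult:
  fixes f m :: "'a::euclidean_space \<Rightarrow> complex"
  assumes "f \<in> schwartz" "m \<in> bounded_smooth"
  shows "(\<lambda>x. f x * m x) \<in> schwartz"
proof -
  have diff: "f differentiable (at x)" if "f \<in> schwartz_products" for f :: "'a \<Rightarrow> complex" and x
    using that
  proof induction
    case (prod f m)
    then show ?case
      by (intro differentiable_mult schwartz_differentiable bounded_smooth_differentiable)
  qed (rule differentiable_add)
  have "(schwartz_products :: ('a \<Rightarrow> complex) set) \<subseteq> schwartz"
  proof (rule schwartz_coinduct)
    fix f :: "'a \<Rightarrow> complex" and b :: 'a
    assume "f \<in> schwartz_products" and b: "b \<in> Basis"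
    then show "(\<lambda>x. frechet_derivative f (at x) b) \<in> schwartz_products"
    proof induction
      case (prod f m)
      then show ?case
        by (auto simp: frechet_derivative_mult_apply schwartz_differentiable bounded_smooth_differentiable
            intro!: schwartz_products.intros schwartz_partial bounded_smooth_partial b)
    next
      case (add f g)
      then show ?case
        by (auto simp: frechet_derivative_add_apply diff intro!: schwartz_products.intros)
    qed
  next
    fix f :: "'a \<Rightarrow> complex" and k
    assume "f \<in> schwartz_products"
    then show "bdd_above (range (\<lambda>x. (1 + norm x) ^ k * norm (f x)))"
    proof induction
      case (prod f m)
      obtain M where M: "M \<ge> 0" "\<And>x. (1 + norm x) ^ k * norm (f x) \<le> M"
        using schwartz_decayE[OF prod(1)] by metis
      obtain N where N: "\<And>x. norm (m x) \<le> N"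
        using prod(2) by (fastforce simp: bounded_smooth_def bdd_above_def dest!: spec[of _ "[]"])
      have "(1 + norm x) ^ k * norm (f x * m x) \<le> M * N" for x
        using mult_mono[OF M(2) N M(1) norm_ge_zero, of x x] by (simp add: norm_mult mult.assoc)
      then show ?case by (auto simp: bdd_above_def)
    next
      case (add f g)
      then show ?case by (intro bdd_above_decay_add)
    qed
  qed (use diff in auto)
  then show ?thesis using assms by (auto intro: schwartz_products.prod)
qed

lemma schwartz_add:
  fixes f g :: "'a::euclidean_space \<Rightarrow> complex"
  assumes "f \<in> schwartz" "g \<in> schwartz"
  shows "(\<lambda>x. f x + g x) \<in> schwartz"
proof -
  let ?X = "{\<lambda>x. f x + g x :: complex | f g :: 'a \<Rightarrow> complex. f \<in> schwartz \<and> g \<in> schwartz}"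
  have "?X \<subseteq> schwartz"
  proof (rule schwartz_coinduct)
    fix h b assume "h \<in> ?X" "b \<in> (Basis :: 'a set)"
    then obtain f g where "h = (\<lambda>x. f x + g x)" and fg: "f \<in> schwartz" "g \<in> schwartz"
      by blast
    moreover have "(\<lambda>x. frechet_derivative (\<lambda>x. f x + g x) (at x) b) =
        (\<lambda>x. frechet_derivative f (at x) b + frechet_derivative g (at x) b)"
      using fg by (simp add: frechet_derivative_add_apply schwartz_differentiable)
    ultimately show "(\<lambda>x. frechet_derivative h (at x) b) \<in> ?X"
      using schwartz_partial[OF fg(1) \<open>b \<in> Basis\<close>] schwartz_partial[OF fg(2) \<open>b \<in> Basis\<close>] by auto
  next
    fix h x assume "h \<in> ?X"
    then show "h differentiable at x"
      using differentiable_add schwartz_differentiable by blast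
  next
    fix h k assume "h \<in> ?X"
    then show "bdd_above (range (\<lambda>x. (1 + norm x) ^ k * norm (h x)))"
      by (auto intro: bdd_above_decay_add schwartz_decay)
  qed
  then show ?thesis using assms by blast
qed

lemma bounded_smooth_const: "(\<lambda>_. c) \<in> bounded_smooth"
proof -
  have "range (\<lambda>c (_ :: 'a). c) \<subseteq> bounded_smooth"
    by (rule bounded_smooth_coinduct) auto
  then show ?thesis by auto
qed

lemma schwartz_cmult: "f \<in> schwartz \<Longrightarrow> (\<lambda>x. c * f x) \<in> schwartz"
  using schwartz_mult[OF _ bounded_smooth_const[of c]] by (simp add: mult.commute)

lemma schwartz_diff:
  "f \<in> schwartz \<Longrightarrow> g \<in> schwartz \<Longrightarrow> (\<lambda>x. f x - g x) \<in> schwartz"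
  using schwartz_add[OF _ schwartz_cmult[of g "-1"], of f] by simp

lemma schwartz_continuous: "f \<in> schwartz \<Longrightarrow> continuous_on UNIV f"
  by (intro differentiable_imp_continuous_on) (simp add: differentiable_on_def schwartz_differentiable)

lemma schwartz_borel: "f \<in> schwartz \<Longrightarrow> f \<in> borel_measurable borel"
  by (intro borel_measurable_continuous_onI schwartz_continuous)

lemma frechet_derivative_1D:
  fixes f :: "real \<Rightarrow> complex"
  assumes "(f has_vector_derivative f') (at x)"
  shows "frechet_derivative f (at x) 1 = f'"
  using fun_cong[OF frechet_derivative_at[OF assms[unfolded has_vector_derivative_def]], of 1] by simp

lemma schwartz_vector_derivative:
  fixes f :: "real \<Rightarrow> complex"
  assumes "f \<in> schwartz"
  shows "(f has_vector_derivative frechet_derivative f (at x) 1) (at x)"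
proof -
  have D: "(f has_derivative frechet_derivative f (at x)) (at x)"
    using schwartz_differentiable[OF assms] frechet_derivative_works by blast
  have "frechet_derivative f (at x) h = h *\<^sub>R frechet_derivative f (at x) 1" for h
    using linear_scale[OF has_derivative_linear[OF D], of h 1] by simp
  then have eq: "(\<lambda>h. h *\<^sub>R frechet_derivative f (at x) 1) = frechet_derivative f (at x)"
    by (intro ext) (rule sym)
  show ?thesis
    unfolding has_vector_derivative_def eq by (rule D)
qed

lemma schwartz_coinduct_1D:
  fixes X :: "(real \<Rightarrow> complex) set"
  assumes step: "\<And>f. f \<in> X \<Longrightarrow> \<exists>f'\<in>X. \<forall>x. (f has_vector_derivative f' x) (at x)"
    and decay: "\<And>f k. f \<in> X \<Longrightarrow> bdd_above (range (\<lambda>x. (1 + norm x) ^ k * norm (f x)))"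
  shows "X \<subseteq> schwartz"
proof (rule schwartz_coinduct)
  fix f x assume "f \<in> X"
  then show "f differentiable at x"
    using step[of f] by (auto simp: has_vector_derivative_def intro: differentiableI)
next
  fix f :: "real \<Rightarrow> complex" and b :: real assume f: "f \<in> X" and b: "b \<in> Basis"
  obtain f' where f': "f' \<in> X" "\<And>x. (f has_vector_derivative f' x) (at x)"
    using step[OF f] by auto
  have "(\<lambda>x. frechet_derivative f (at x) b) = f'"
    using b f'(2) by (auto simp: frechet_derivative_1D)
  then show "(\<lambda>x. frechet_derivative f (at x) b) \<in> X" using f'(1) by simp
qed (use decay in auto)


section \<open>Bump functions and a smooth step\<close>

text \<open>The classical functions \<open>exp (-1/t) / t\<^sup>n\<close>, extended by 0 to
  \<open>t \<le> 0\<close>. All powers of \<open>1/t\<close> are included because differentiation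
  of \<open>exp (-1/t)\<close> produces them.\<close>

definition flat :: "nat \<Rightarrow> real \<Rightarrow> real" where
  "flat n t = (if t \<le> 0 then 0 else exp (- 1 / t) / t ^ n)"

lemma flat_nonneg: "flat n t \<ge> 0"
  by (auto simp: flat_def)

text \<open>One term of the exponential series gives \<open>exp (1/t) \<ge>
  (1/t)\<^sup>n\<^sup>+\<^sup>k / (n+k)!\<close>. With \<open>k = 0\<close> this is boundedness,
  with \<open>k = 2\<close> it yields the derivative 0 at the origin.\<close>

lemma flat_le:
  assumes "t \<ge> 0"
  shows "flat n t \<le> fact (n + k) * t ^ k"
proof (cases "t = 0")
  case True
  then show ?thesis by (simp add: flat_def)
next
  case False
  with assms have t: "t > 0" by simp
  have "(1 / t) ^ (n + k) / fact (n + k) \<le> exp (1 / t)"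
  proof -
    have "(\<Sum>i\<in>{n + k}. inverse (fact i) * (1 / t) ^ i) \<le> (\<Sum>i. inverse (fact i) * (1 / t) ^ i)"
      using t by (intro sum_le_suminf summable_exp) auto
    then show ?thesis
      by (simp add: exp_def scaleR_conv_of_real field_simps)
  qed
  then have "exp (- 1 / t) \<le> fact (n + k) * t ^ (n + k)"
    using t by (simp add: exp_minus field_simps power_divide)
  then show ?thesis
    using t by (simp add: flat_def field_simps power_add)
qed

lemma flat_deriv:
  "(flat n has_real_derivative flat (n + 2) t - n * flat (n + 1) t) (at t)"
proof (cases t "0 :: real" rule: linorder_cases)
  case less
  have "((\<lambda>_. 0) has_real_derivative flat (n + 2) t - n * flat (n + 1) t) (at t)"
    using less by (simp add: flat_def)
  then show ?thesis
    by (rule has_field_derivative_transform_within_open[of _ _ _ "{..<0}"])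
      (use less in \<open>auto simp: flat_def\<close>)
next
  case greater
  have "((\<lambda>t. exp (- 1 / t) / t ^ n) has_real_derivative flat (n + 2) t - n * flat (n + 1) t) (at t)"
  proof -
    have "((\<lambda>t. exp (- 1 / t)) has_real_derivative exp (- 1 / t) / t\<^sup>2) (at t)"
      using greater by (auto intro!: derivative_eq_intros simp: field_simps power2_eq_square)
    moreover have "((\<lambda>t. t ^ n) has_real_derivative n * t ^ (n - 1)) (at t)"
      using DERIV_pow[of n t] by simp
    ultimately have "((\<lambda>t. exp (- 1 / t) / t ^ n) has_real_derivative
        (exp (- 1 / t) / t\<^sup>2 * t ^ n - exp (- 1 / t) * (n * t ^ (n - 1))) / (t ^ n * t ^ n)) (at t)"
      by (rule DERIV_divide) (use greater in simp)
    moreover have "(e / t\<^sup>2 * t ^ n - e * (n * t ^ (n - 1))) / (t ^ n * t ^ n)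
        = e / t ^ (n + 2) - n * (e / t ^ (n + 1))" for e
    proof (cases n)
      case (Suc k)
      have "t ^ k \<noteq> 0" "t \<noteq> 0" using greater by auto
      then show ?thesis
        unfolding Suc by (simp add: field_simps power2_eq_square)
    qed (simp add: power2_eq_square)
    then have "(exp (- 1 / t) / t\<^sup>2 * t ^ n - exp (- 1 / t) * (n * t ^ (n - 1))) / (t ^ n * t ^ n)
        = flat (n + 2) t - n * flat (n + 1) t"
      using greater by (simp only: flat_def not_le[symmetric] if_False)
    ultimately show ?thesis by simp
  qed
  then show ?thesis
    by (rule has_field_derivative_transform_within_open[of _ _ _ "{0<..}"])
      (use greater in \<open>auto simp: flat_def\<close>)
next
  case equal
  have "((\<lambda>h. (flat n (0 + h) - flat n 0) / h) \<longlongrightarrow> 0) (at 0)"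
  proof (rule Lim_null_comparison[of _ "\<lambda>h. fact (n + 2) * \<bar>h\<bar>"])
    show "\<forall>\<^sub>F h in at 0. norm ((flat n (0 + h) - flat n 0) / h) \<le> fact (n + 2) * \<bar>h\<bar>"
    proof (rule eventuallyI)
      fix h :: real
      show "norm ((flat n (0 + h) - flat n 0) / h) \<le> fact (n + 2) * \<bar>h\<bar>"
      proof (cases "h > 0")
        case True
        have "flat n h / h \<le> fact (n + 2) * h"
          using flat_le[of h n 2] True by (simp add: field_simps power2_eq_square)
        then show ?thesis using True flat_nonneg[of n h] by (simp add: flat_def[of n 0])
      next
        case False
        then have "flat n (0 + h) - flat n 0 = 0" by (simp add: flat_def)
        then show ?thesis by (simp only: div_0 norm_zero) simp
      qed
    qed
    show "((\<lambda>h. fact (n + 2) * \<bar>h\<bar>) \<longlongrightarrow> 0) (at (0::real))"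
      by (auto intro!: tendsto_eq_intros)
  qed
  then show ?thesis using equal by (simp add: DERIV_def flat_def[of _ 0])
qed

text \<open>The class to which coinduction is applied in order to see that bump functions on
  \<open>[p, q]\<close> are Schwartz functions; the factor \<open>r\<close> sharpens the
  flanks.\<close>

inductive_set bumps :: "real \<Rightarrow> real \<Rightarrow> real \<Rightarrow> (real \<Rightarrow> complex) set" for r p q where
  base: "(\<lambda>x. c * of_real (flat m (r * (x - p)) * flat n (r * (q - x)))) \<in> bumps r p q"
| add: "f \<in> bumps r p q \<Longrightarrow> g \<in> bumps r p q \<Longrightarrow> (\<lambda>x. f x + g x) \<in> bumps r p q"

lemma bumps_schwartz:
  assumes "r > 0"
  shows "bumps r p q \<subseteq> schwartz"
proof (rule schwartz_coinduct_1D)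
  fix f assume "f \<in> bumps r p q"
  then show "\<exists>f'\<in>bumps r p q. \<forall>x. (f has_vector_derivative f' x) (at x)"
  proof induction
    case (base c m n)
    define t where "t m n = (\<lambda>x. flat m (r * (x - p)) * flat n (r * (q - x)))" for m n
    have D: "(t m n has_real_derivative
      r * t (m+2) n x + (- r * m) * t (m+1) n x + (- r) * t m (n+2) x + r * n * t m (n+1) x) (at x)" for x
    proof -
      have "((\<lambda>x. flat m (r * (x - p))) has_real_derivative
          (flat (m + 2) (r * (x - p)) - m * flat (m + 1) (r * (x - p))) * r) (at x)"
        by (rule DERIV_chain2[OF flat_deriv]) (auto intro!: derivative_eq_intros)
      moreover
      have "((\<lambda>x. flat n (r * (q - x))) has_real_derivative
          (flat (n + 2) (r * (q - x)) - n * flat (n + 1) (r * (q - x))) * (- r)) (at x)"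
        by (rule DERIV_chain2[OF flat_deriv]) (auto intro!: derivative_eq_intros)
      ultimately show ?thesis
        unfolding t_def
        by (rule DERIV_cong[OF DERIV_mult]) (simp add: algebra_simps)
    qed
    have T: "(\<lambda>x. d * of_real (t m n x)) \<in> bumps r p q" for d m n
      unfolding t_def by (rule bumps.base)
    let ?g = "\<lambda>x. c * of_real r * of_real (t (m+2) n x) + c * of_real (- r * m) * of_real (t (m+1) n x)
        + c * of_real (- r) * of_real (t m (n+2) x) + c * of_real (r * n) * of_real (t m (n+1) x)"
    have "?g \<in> bumps r p q"
      by (intro bumps.add T)
    moreover have "((\<lambda>x. c * of_real (t m n x)) has_vector_derivative ?g x) (at x)" for x
    proof -
      have "((\<lambda>x. c * of_real (t m n x)) has_vector_derivative c * of_real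
       (r * t (m+2) n x + (- r * m) * t (m+1) n x + (- r) * t m (n+2) x + r * n * t m (n+1) x)) (at x)"
        by (intro has_vector_derivative_mult_right has_vector_derivative_of_real
D)
      then show ?thesis by (simp only: of_real_add of_real_mult distrib_left mult.assoc)
    qed
    ultimately have "\<exists>g\<in>bumps r p q. \<forall>x. ((\<lambda>x. c * of_real (t m n x)) has_vector_derivative g x) (at x)"
      by (intro bexI[of _ ?g] allI)
    then show ?case by (simp only: t_def)
  next
    case (add f g)
    then obtain f' g' where "f' \<in> bumps r p q" "g' \<in> bumps r p q"
      "\<forall>x. (f has_vector_derivative f' x) (at x)" "\<forall>x. (g has_vector_derivative g' x) (at x)"
      by auto
    then show ?case
      by (intro bexI[of _ "\<lambda>x. f' x + g' x"] allI has_vector_derivative_add bumps.add) simp_all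
  qed
next
  fix f k assume "f \<in> bumps r p q"
  then show "bdd_above (range (\<lambda>x. (1 + norm x) ^ k * norm (f x)))"
  proof induction
    case (base c m n)
    have le: "flat m t \<le> fact m" for m t
      using flat_le[of t m 0] by (cases "t \<ge> 0") (auto simp: flat_def)
    have "(1 + norm x) ^ k * norm (c * of_real (flat m (r * (x - p)) * flat n (r * (q - x))))
        \<le> (1 + \<bar>p\<bar> + \<bar>q\<bar>) ^ k * (norm c * (fact m * fact n))" for x
    proof (cases "p < x \<and> x < q")
      case True
      then have x: "1 + norm x \<le> 1 + \<bar>p\<bar> + \<bar>q\<bar>" by auto
      have "flat m (r * (x - p)) * flat n (r * (q - x)) \<le> fact m * fact n"
        by (intro mult_mono le flat_nonneg) simp
      then have "norm (c * of_real (flat m (r * (x - p)) * flat n (r * (q - x)))) \<le> norm c * (fact m * fact n)"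
        by (simp only: norm_mult norm_of_real abs_mult abs_of_nonneg flat_nonneg mult_left_mono norm_ge_zero)
      then show ?thesis
        using x by (intro mult_mono power_mono) simp_all
    next
      case False
      then have "r * (x - p) \<le> 0 \<or> r * (q - x) \<le> 0"
        using assms by (auto simp: mult_le_0_iff)
      then have "flat m (r * (x - p)) * flat n (r * (q - x)) = 0"
        by (auto simp: flat_def)
      then show ?thesis by (simp only: of_real_0 mult_zero_right norm_zero) simp
    qed
    then show ?case unfolding bdd_above_def by blast
  qed (rule bdd_above_decay_add)
qed

definition bump :: "real \<Rightarrow> real \<Rightarrow> real \<Rightarrow> real \<Rightarrow> real" where
  "bump r p q x = flat 0 (r * (x - p)) * flat 0 (r * (q - x))"

lemma bump_schwartz: "r > 0 \<Longrightarrow> (\<lambda>x. of_real (bump r p q x)) \<in> schwartz"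
  using bumps_schwartz[of r p q] bumps.base[of 1 0 r p 0 q] by (auto simp: bump_def)

lemma bump_borel [measurable]: "bump r p q \<in> borel_measurable borel"
proof -
  have [measurable]: "flat 0 \<in> borel_measurable borel"
    by (intro borel_measurable_continuous_onI DERIV_continuous_on) (rule flat_deriv)
  show ?thesis unfolding bump_def[abs_def] by measurable
qed

lemma bump_nonneg: "bump r p q x \<ge> 0"
  by (simp add: bump_def flat_nonneg)

lemma bump_le_1: "bump r p q x \<le> 1"
  unfolding bump_def by (intro mult_le_one flat_nonneg) (auto simp: flat_def)

lemma bump_pos: "r > 0 \<Longrightarrow> p < x \<Longrightarrow> x < q \<Longrightarrow> bump r p q x > 0"
  by (simp add: bump_def flat_def not_le)

lemma bump_eq_0: "r > 0 \<Longrightarrow> x \<le> p \<or> q \<le> x \<Longrightarrow> bump r p q x = 0"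
  by (auto simp: bump_def flat_def mult_le_0_iff)

text \<open>As the flanks get steeper the bump fills the whole interval. The left end is moved to
  \<open>p + 1/(n+1)\<close> so that the support keeps a positive distance from everything to the
  left of \<open>p\<close>; two adjacent intervals can then be approximated by bumps with
  separated supports.\<close>

lemma bump_tendsto_indicator:
  assumes "p < q"
  shows "(\<lambda>n. bump (Suc n) (p + 1 / Suc n) q x) \<longlonglongrightarrow> indicator {p<..<q} x"
proof (cases "p < x \<and> x < q")
  case True
  have *: "(\<lambda>n. flat 0 (f n)) \<longlonglongrightarrow> 1" if "filterlim f at_top sequentially" for f
  proof -
    have "(\<lambda>n. exp (- (1 / f n))) \<longlonglongrightarrow> exp (- 0)"
      by (intro tendsto_intros tendsto_divide_0[OF tendsto_const] filterlim_at_top_imp_at_infinity that)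
    moreover have "\<forall>\<^sub>F n in sequentially. exp (- (1 / f n)) = flat 0 (f n)"
      using filterlim_at_top_dense[THEN iffD1, OF that, rule_format, of 0]
      by eventually_elim (simp add: flat_def)
    ultimately show ?thesis by (simp add: filterlim_cong)
  qed
  have lin: "filterlim (\<lambda>n. real (Suc n) * y - d) at_top sequentially" if "y > 0" for y d :: real
  proof -
    have "filterlim (\<lambda>n. - d + real (Suc n) * y) at_top sequentially"
      by (intro filterlim_tendsto_add_at_top[OF tendsto_const] filterlim_at_top_mult_tendsto_pos[OF tendsto_const that]
        filterlim_compose[OF filterlim_real_sequentially filterlim_Suc])
    then show ?thesis by (simp add: algebra_simps)
  qed
  have "(\<lambda>n. flat 0 (real (Suc n) * (x - p) - 1) * flat 0 (real (Suc n) * (q - x) - 0)) \<longlonglongrightarrow> 1 * 1"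
    using True by (intro tendsto_mult * lin) auto
  moreover have "real (Suc n) * (x - (p + 1 / real (Suc n))) = real (Suc n) * (x - p) - 1" for n
    by (simp add: field_simps)
  ultimately show ?thesis using True by (simp add: bump_def)
next
  case False
  have "bump (Suc n) (p + 1 / Suc n) q x = 0" for n
  proof (rule bump_eq_0)
    have "0 < 1 / real (Suc n)" by simp
    then show "x \<le> p + 1 / real (Suc n) \<or> q \<le> x" using False by linarith
  qed simp
  moreover have "indicator {p<..<q} x = (0::real)" using False by auto
  ultimately show ?thesis by (simp only: tendsto_const)
qed


lemma bounded_smooth_antiderivative:
  fixes S s :: "real \<Rightarrow> complex"
  assumes s: "s \<in> schwartz"
    and deriv: "\<And>x. (S has_vector_derivative s x) (at x)"
    and bound: "\<And>x. norm (S x) \<le> M"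
  shows "S \<in> bounded_smooth"
proof -
  have "insert S bounded_smooth \<subseteq> bounded_smooth"
  proof (rule bounded_smooth_coinduct)
    fix f x assume "f \<in> insert S bounded_smooth"
    moreover have "S differentiable (at x)"
      using deriv[of x] by (auto simp: has_vector_derivative_def intro: differentiableI)
    ultimately show "f differentiable (at x)"
      using bounded_smooth_differentiable by auto
  next
    fix f :: "real \<Rightarrow> complex" and b :: real
    assume f: "f \<in> insert S bounded_smooth" and b: "b \<in> Basis"
    have "(\<lambda>x. frechet_derivative S (at x) b) = s"
      using b deriv by (auto simp: frechet_derivative_1D)
    then have "(\<lambda>x. frechet_derivative S (at x) b) \<in> bounded_smooth"
      using s schwartz_subset_bounded_smooth by auto
    then show "(\<lambda>x. frechet_derivative f (at x) b) \<in> insert S bounded_smooth"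
      using f bounded_smooth_partial[OF _ b] by auto
  next
    fix f assume f: "f \<in> insert S bounded_smooth"
    have "bdd_above (range (\<lambda>x. norm (f x)))" if "f \<in> bounded_smooth"
      using that by (auto simp: bounded_smooth_def dest!: spec[of _ "[]"])
    moreover have "bdd_above (range (\<lambda>x. norm (S x)))"
      using bound by (auto simp: bdd_above_def)
    ultimately show "bdd_above (range (\<lambda>x. norm (f x)))" using f by auto
  qed
  then show ?thesis by simp
qed

text \<open>A primitive of a bump on \<open>[1, 2]\<close>, divided by its total increase.\<close>

lemma smooth_step:
  obtains S :: "real \<Rightarrow> complex"
  where "S \<in> bounded_smooth" "\<And>x. x \<le> 1 \<Longrightarrow> S x = 0" "\<And>x. x \<ge> 2 \<Longrightarrow> S x = 1"
proof -
  define b where "b = bump 1 1 2"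
  have b_schwartz: "(\<lambda>x. of_real (b x)) \<in> schwartz"
    unfolding b_def by (rule bump_schwartz) simp
  have "continuous_on UNIV (\<lambda>x. Re (of_real (b x)))"
    by (intro continuous_on_Re schwartz_continuous b_schwartz)
  then have cont: "continuous_on UNIV b" by simp
  define I where "I u = (LBINT y=0..u. b y)" for u :: real
  have I_deriv: "(I has_real_derivative b x) (at x)" for x
  proof -
    have "((\<lambda>u. LBINT y=ereal 0..ereal u. b y) has_vector_derivative b x)
        (at x within {min 0 x - 1..max 0 x + 1})"
      by (rule interval_integral_FTC2) (auto intro: continuous_on_subset[OF cont])
    moreover have "at x within {min 0 x - 1..max 0 x + 1} = at x"
      by (rule at_within_Icc_at) auto
    ultimately show ?thesis
      by (simp add: I_def[abs_def] has_real_derivative_iff_has_vector_derivative zero_ereal_def)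
  qed
  have const: "I x = I y" if "convex T" "x \<in> T" "y \<in> T" "\<And>t. t \<in> T \<Longrightarrow> b t = 0" for T x y
  proof -
    have "\<exists>c. \<forall>t\<in>T. I t = c"
      by (rule has_field_derivative_zero_constant[OF that(1)])
        (use I_deriv that(4) has_field_derivative_at_within in metis)
    then show ?thesis using that by auto
  qed
  have left: "I x = 0" if "x \<le> 1" for x
    using const[of "{..1}" x 0] that by (auto simp: b_def bump_eq_0 I_def zero_ereal_def[symmetric])
  have right: "I x = I 2" if "x \<ge> 2" for x
    using const[of "{2..}" x 2] that by (auto simp: b_def bump_eq_0)
  have "I 1 < I 2"
  proof (rule DERIV_pos_imp_increasing_open[of 1 2 I])
    show "\<exists>y. (I has_real_derivative y) (at x) \<and> 0 < y" if "1 < x" "x < 2" for x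
      using I_deriv[of x] bump_pos[of 1 1 x 2] that by (auto simp: b_def)
    show "continuous_on {1..2} I"
      by (rule DERIV_continuous_on) (use I_deriv has_field_derivative_at_within in blast)
  qed simp
  then have pos: "I 2 > 0" using left[of 1] by simp
  have mono: "I x \<le> I y" if "x \<le> y" for x y
    by (rule DERIV_nonneg_imp_nondecreasing[OF that])
      (rule exI conjI I_deriv bump_nonneg[of 1 1 2, folded b_def])+
  have bound: "0 \<le> I x \<and> I x \<le> I 2" for x
    using mono[of x 2] mono[of 1 x] left[of x] right[of x] left[of 1]
    by (cases "x \<le> 1"; cases "x \<ge> 2") auto
  define S where "S x = complex_of_real (I x / I 2)" for x
  have "S \<in> bounded_smooth"
  proof (rule bounded_smooth_antiderivative)
    show "(\<lambda>x. of_real (1 / I 2) * of_real (b x)) \<in> schwartz"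
      by (rule schwartz_cmult[OF b_schwartz])
    show "(S has_vector_derivative of_real (1 / I 2) * of_real (b x)) (at x)" for x
    proof -
      have "((\<lambda>x. of_real (1 / I 2) * of_real (I x)) has_vector_derivative
          complex_of_real (1 / I 2) * of_real (b x)) (at x)"
        by (intro has_vector_derivative_mult_right has_vector_derivative_of_real I_deriv)
      then show ?thesis by (simp add: S_def[abs_def])
    qed
    show "norm (S x) \<le> 1" for x
      unfolding S_def norm_of_real using bound[of x] pos by simp
  qed
  moreover have "S x = 0" if "x \<le> 1" for x using left that by (simp add: S_def)
  moreover have "S x = 1" if "x \<ge> 2" for x using right[OF that] pos by (simp add: S_def)
  ultimately show ?thesis by (rule that)
qed


section \<open>Integrals against rapidly decaying functions\<close>

text \<open>This weight is integrable, Schwartz functions are bounded by multiples of it, and it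
  decays fast enough to absorb the growth of \<open>|x - y|\<^sup>3\<^sup>/\<^sup>2\<close> in
  either variable.\<close>

definition weight :: "real \<Rightarrow> real" where
  "weight x = 1 / (1 + \<bar>x\<bar>)\<^sup>2"

lemma weight_pos: "weight x > 0"
  by (simp add: weight_def)

lemma weight_borel [measurable]: "weight \<in> borel_measurable borel"
  unfolding weight_def[abs_def] by measurable

lemma weight_integrable: "integrable lborel weight"
proof (rule Bochner_Integration.integrable_bound)
  show "integrable lborel (\<lambda>x::real. inverse (1 + x\<^sup>2))"
    using integrable_inverse_1_plus_square by (simp add: set_integrable_def)
  show "AE x in lborel. norm (weight x) \<le> norm (inverse (1 + x\<^sup>2))"
  proof (rule AE_I2)
    fix x :: real
    have "1 + x\<^sup>2 \<le> (1 + \<bar>x\<bar>)\<^sup>2" by (simp add: power2_eq_square algebra_simps)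
    then show "norm (weight x) \<le> norm (inverse (1 + x\<^sup>2))"
      by (simp add: weight_def divide_simps add_pos_nonneg)
  qed
qed simp

lemma schwartz_weight_bound:
  fixes f :: "real \<Rightarrow> complex"
  assumes "f \<in> schwartz"
  obtains M where "M \<ge> 0" "\<And>x. norm (f x) \<le> M * weight x"
proof -
  obtain M where "M \<ge> 0" and M: "\<And>x. (1 + norm x) ^ 2 * norm (f x) \<le> M"
    using schwartz_decayE[OF assms] by metis
  have "norm (f x) \<le> M * weight x" for x
  proof -
    have "(1 + \<bar>x\<bar>)\<^sup>2 > 0" by (simp add: add_pos_nonneg)
    then show ?thesis using M[of x] by (simp add: weight_def field_simps)
  qed
  then show thesis using that \<open>M \<ge> 0\<close> by blast
qed

lemma schwartz_integrable:
  fixes f :: "real \<Rightarrow> complex"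
  assumes "f \<in> schwartz"
  shows "integrable lborel f"
proof -
  obtain M where M: "\<And>x. norm (f x) \<le> M * weight x"
    using schwartz_weight_bound[OF assms] by metis
  show ?thesis
    by (rule Bochner_Integration.integrable_bound[of _ "\<lambda>x. M * weight x"])
      (use weight_integrable schwartz_borel[OF assms] order_trans[OF M abs_ge_self] in auto)
qed


section \<open>Off-diagonal test functions\<close>

lemma partial_derivs_eq_0_on_open:
  assumes "open U" "\<And>z. z \<in> U \<Longrightarrow> f z = 0" "z \<in> U"
  shows "partial_derivs bs f z = 0"
  using assms(3)
proof (induction bs arbitrary: z)
  case (Cons b bs)
  have "(partial_derivs bs f has_derivative (\<lambda>_. 0)) (at z)"
    by (rule has_derivative_transform_within_open[OF has_derivative_const[of 0] assms(1) Cons.prems])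
      (use Cons.IH in simp)
  then show ?case by (simp flip: frechet_derivative_at)
qed (use assms in simp)

lemma schwartz_swap:
  fixes f :: "real \<times> real \<Rightarrow> complex"
  assumes "f \<in> schwartz"
  shows "(\<lambda>z. f (prod.swap z)) \<in> schwartz"
proof -
  let ?X = "(\<lambda>f z. f (prod.swap z)) ` (schwartz :: (real \<times> real \<Rightarrow> complex) set)"
  have deriv: "((\<lambda>z. f (prod.swap z)) has_derivative
      (\<lambda>h. frechet_derivative f (at (prod.swap z)) (prod.swap h))) (at z)" if "f \<in> schwartz"
    for f :: "real \<times> real \<Rightarrow> complex" and z
  proof -
    have "(f has_derivative frechet_derivative f (at (prod.swap z))) (at (prod.swap z))"
      using schwartz_differentiable[OF that] frechet_derivative_works by blast
    moreover have "(prod.swap has_derivative prod.swap) (at z)"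
      unfolding prod.swap_def by (intro derivative_intros)
    ultimately show ?thesis by (rule has_derivative_compose[rotated])
  qed
  have "?X \<subseteq> schwartz"
  proof (rule schwartz_coinduct)
    fix h z assume "h \<in> ?X"
    then show "h differentiable at z" using differentiableI[OF deriv] by blast
  next
    fix h and b :: "real \<times> real" assume "h \<in> ?X" and b: "b \<in> Basis"
    then obtain f where f: "f \<in> schwartz" "h = (\<lambda>z. f (prod.swap z))" by auto
    have "(\<lambda>z. frechet_derivative h (at z) b)
        = (\<lambda>z. (\<lambda>w. frechet_derivative f (at w) (prod.swap b)) (prod.swap z))"
    proof
      show "frechet_derivative h (at z) b = frechet_derivative f (at (prod.swap z)) (prod.swap b)" for z
        unfolding f(2) by (rule fun_cong[OF frechet_derivative_at[OF deriv[OF f(1)], symmetric]])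
    qed
    moreover have "prod.swap b \<in> Basis" using b by (auto simp: Basis_prod_def)
    ultimately show "(\<lambda>z. frechet_derivative h (at z) b) \<in> ?X"
      by (intro image_eqI[where x = "\<lambda>w. frechet_derivative f (at w) (prod.swap b)"] schwartz_partial f(1))
  next
    fix h k assume "h \<in> ?X"
    then obtain f where f: "f \<in> schwartz" "h = (\<lambda>z. f (prod.swap z))" by auto
    obtain M where M: "\<And>x. (1 + norm x) ^ k * norm (f x) \<le> M"
      using schwartz_decayE[OF f(1)] by metis
    have "norm (prod.swap z) = norm z" for z :: "real \<times> real"
      by (cases z) (simp add: norm_Pair add.commute)
    then have "(1 + norm z) ^ k * norm (h z) \<le> M" for z
      using M[of "prod.swap z"] f(2) by simp
    then show "bdd_above (range (\<lambda>x. (1 + norm x) ^ k * norm (h x)))"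
      by (auto simp: bdd_above_def)
  qed
  then show ?thesis using assms by blast
qed

text \<open>Since \<open>a\<close> lives on the left of \<open>p\<close> and \<open>b\<close> on
  the right of \<open>q\<close>, only the region \<open>y - x \<ge> q - p > 0\<close> matters,
  where every real power of \<open>y - x\<close> is smooth. Arbitrary exponents \<open>s\<close>
  and the factor \<open>c\<close> are needed for closure under derivatives.\<close>

inductive_set separated_kernels :: "real \<Rightarrow> real \<Rightarrow> (real \<times> real \<Rightarrow> complex) set" for p q where
  base: "a \<in> schwartz \<Longrightarrow> b \<in> schwartz \<Longrightarrow> (\<And>x. x > p \<Longrightarrow> a x = 0) \<Longrightarrow> (\<And>y. y < q \<Longrightarrow> b y = 0) \<Longrightarrow>
    (\<lambda>z. of_real (c * (snd z - fst z) powr s) * (a (fst z) * b (snd z))) \<in> separated_kernels p q"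
| add: "f \<in> separated_kernels p q \<Longrightarrow> g \<in> separated_kernels p q \<Longrightarrow>
    (\<lambda>z. f z + g z) \<in> separated_kernels p q"

lemma schwartz_deriv_eq_0_on_open:
  fixes f :: "real \<Rightarrow> complex"
  assumes "open U" "\<And>z. z \<in> U \<Longrightarrow> f z = 0" "z \<in> U"
  shows "frechet_derivative f (at z) 1 = 0"
  using partial_derivs_eq_0_on_open[OF assms, where bs = "[1]"] by simp

text \<open>Where \<open>y > x\<close> this is the product rule. Elsewhere the function and its
  supposed derivatives vanish in the neighbourhood \<open>y - x < q - p\<close>, so the
  singularity of the power never shows.\<close>

lemma separated_kernels_deriv:
  assumes "p < q" "f \<in> separated_kernels p q"
  shows "\<exists>f1\<in>separated_kernels p q. \<exists>f2\<in>separated_kernels p q. \<forall>z.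
    (f has_derivative (\<lambda>h. of_real (fst h) * f1 z + of_real (snd h) * f2 z)) (at z)"
  using assms(2)
proof induction
  case (base a b c s)
  define a' b' where "a' = (\<lambda>x. frechet_derivative a (at x) 1)"
    and "b' = (\<lambda>x. frechet_derivative b (at x) 1)"
  have ab': "a' \<in> schwartz" "b' \<in> schwartz"
    using base by (auto simp: a'_def b'_def intro: schwartz_partial)
  have a'0: "a' x = 0" if "x > p" for x
    unfolding a'_def by (rule schwartz_deriv_eq_0_on_open[of "{p<..}"]) (use base that in auto)
  have b'0: "b' y = 0" if "y < q" for y
    unfolding b'_def by (rule schwartz_deriv_eq_0_on_open[of "{..<q}"]) (use base that in auto)
  define K where "K c s a b = (\<lambda>z. complex_of_real (c * (snd z - fst z) powr s) * (a (fst z) * b (snd z)))"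
    for c s :: real and a b :: "real \<Rightarrow> complex"
  have K: "K d t f g \<in> separated_kernels p q"
    if "f \<in> {a, a'}" "g \<in> {b, b'}" for d t f g
    unfolding K_def by (rule separated_kernels.base) (use that base ab' a'0 b'0 in auto)
  define f1 where "f1 = (\<lambda>z. K (- c * s) (s - 1) a b z + K c s a' b z)"
  define f2 where "f2 = (\<lambda>z. K (c * s) (s - 1) a b z + K c s a b' z)"
  have "(K c s a b has_derivative (\<lambda>h. of_real (fst h) * f1 z + of_real (snd h) * f2 z)) (at z)" for z
  proof (cases "snd z - fst z > 0")
    case True
    have "((\<lambda>z. a (fst z)) has_derivative (\<lambda>h. fst h *\<^sub>R a' (fst z))) (at z)"
      using schwartz_vector_derivative[OF base(1), of "fst z"]
      unfolding a'_def has_vector_derivative_def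
      by (rule has_derivative_compose[OF has_derivative_fst[OF has_derivative_ident]])
    moreover have "((\<lambda>z. b (snd z)) has_derivative (\<lambda>h. snd h *\<^sub>R b' (snd z))) (at z)"
      using schwartz_vector_derivative[OF base(2), of "snd z"]
      unfolding b'_def has_vector_derivative_def
      by (rule has_derivative_compose[OF has_derivative_snd[OF has_derivative_ident]])
    moreover have "((\<lambda>z. c * (snd z - fst z) powr s) has_derivative
        (\<lambda>h. c * s * (snd z - fst z) powr (s - 1) * (snd h - fst h))) (at z)"
    proof -
      have "((\<lambda>t. c * t powr s) has_real_derivative c * (s * (snd z - fst z) powr (s - 1))) (at (snd z - fst z))"
        by (intro DERIV_cmult has_real_derivative_powr True)
      then have "((\<lambda>t. c * t powr s) has_derivative (*) (c * (s * (snd z - fst z) powr (s - 1)))) (at (snd z - fst z))"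
        by (simp add: has_field_derivative_def)
      moreover have "((\<lambda>z. snd z - fst z) has_derivative (\<lambda>h. snd h - fst h)) (at z)"
        by (intro derivative_intros)
      ultimately show ?thesis
        using has_derivative_compose by (fastforce simp: mult.assoc)
    qed
    ultimately show ?thesis
      unfolding K_def f1_def f2_def
      by (intro has_derivative_eq_rhs[OF has_derivative_mult[OF has_derivative_of_real has_derivative_mult]])
        (auto simp: scaleR_conv_of_real algebra_simps)
  next
    case False
    let ?U = "{z :: real \<times> real. snd z - fst z < q - p}"
    have zero: "a x * b y = 0"
      if "y - x < q - p" "\<And>x. x > p \<Longrightarrow> a x = 0" "\<And>y. y < q \<Longrightarrow> b y = 0"
      for a b :: "real \<Rightarrow> complex" and x y
      using that(2)[of x] that(3)[of y] that(1) by (cases "x > p") auto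
    have U: "open ?U" by (intro open_Collect_less continuous_intros)
    have z: "z \<in> ?U" using False assms(1) by simp
    have K0: "K c s a b w = 0" if "w \<in> ?U" "\<And>x. x > p \<Longrightarrow> a x = 0" "\<And>y. y < q \<Longrightarrow> b y = 0" for c s a b w
      unfolding K_def using zero[of "snd w" "fst w" a b] that by auto
    have "f1 z = 0" "f2 z = 0"
      unfolding f1_def f2_def using z base a'0 b'0 by (simp_all only: K0 add_0_right)
    moreover have "(K c s a b has_derivative (\<lambda>_. 0)) (at z)"
      by (rule has_derivative_transform_within_open[OF has_derivative_const[of 0] U z])
        (use K0 base in simp)
    ultimately show ?thesis by simp
  qed
  moreover have "f1 \<in> separated_kernels p q" "f2 \<in> separated_kernels p q"
    unfolding f1_def f2_def by (auto intro!: separated_kernels.add K)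
  ultimately show ?case unfolding K_def by blast
next
  case (add f g)
  then obtain f1 f2 g1 g2 where
    "f1 \<in> separated_kernels p q" "f2 \<in> separated_kernels p q" "g1 \<in> separated_kernels p q" "g2 \<in> separated_kernels p q"
    and D: "\<And>z. (f has_derivative (\<lambda>h. of_real (fst h) * f1 z + of_real (snd h) * f2 z)) (at z)"
    "\<And>z. (g has_derivative (\<lambda>h. of_real (fst h) * g1 z + of_real (snd h) * g2 z)) (at z)"
    by blast
  moreover have "((\<lambda>z. f z + g z) has_derivative
      (\<lambda>h. of_real (fst h) * (f1 z + g1 z) + of_real (snd h) * (f2 z + g2 z))) (at z)" for z
    by (rule has_derivative_eq_rhs[OF has_derivative_add[OF D]]) (simp add: algebra_simps)
  ultimately show ?case
    by (intro bexI[of _ "\<lambda>z. f1 z + g1 z"] bexI[of _ "\<lambda>z. f2 z + g2 z"] allI separated_kernels.add)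
qed

lemma separated_kernels_schwartz:
  assumes "p < q"
  shows "separated_kernels p q \<subseteq> schwartz"
proof (rule schwartz_coinduct)
  fix f z assume "f \<in> separated_kernels p q"
  then show "f differentiable at z"
    using separated_kernels_deriv[OF assms] by (blast intro: differentiableI)
next
  fix f and e :: "real \<times> real" assume f: "f \<in> separated_kernels p q" and e: "e \<in> Basis"
  obtain f1 f2 where f12: "f1 \<in> separated_kernels p q" "f2 \<in> separated_kernels p q"
    and D: "\<And>z. (f has_derivative (\<lambda>h. of_real (fst h) * f1 z + of_real (snd h) * f2 z)) (at z)"
    using separated_kernels_deriv[OF assms f] by blast
  have "(\<lambda>z. frechet_derivative f (at z) e) = (\<lambda>z. of_real (fst e) * f1 z + of_real (snd e) * f2 z)"
    by (intro ext fun_cong[OF frechet_derivative_at[OF D, symmetric]])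
  then show "(\<lambda>z. frechet_derivative f (at z) e) \<in> separated_kernels p q"
    using e f12 by (auto simp: Basis_prod_def)
next
  fix f k assume "f \<in> separated_kernels p q"
  then show "bdd_above (range (\<lambda>z. (1 + norm z) ^ k * norm (f z)))"
  proof induction
    case (base a b c s)
    define n where "n = nat \<lceil>\<bar>s\<bar>\<rceil>"
    obtain A where A: "A \<ge> 0" "\<And>x. (1 + norm x) ^ (k + n) * norm (a x) \<le> A"
      using schwartz_decayE[OF base(1)] by metis
    obtain B where B: "\<And>x. (1 + norm x) ^ (k + n) * norm (b x) \<le> B"
      using schwartz_decayE[OF base(2)] by metis
    let ?C = "\<bar>c\<bar> * (1 + (q - p) powr s)"
    have "(1 + norm z) ^ k * norm (of_real (c * (snd z - fst z) powr s) * (a (fst z) * b (snd z)))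
        \<le> ?C * (A * B)" for z
    proof (cases "fst z \<le> p \<and> snd z \<ge> q")
      case False
      then have "a (fst z) * b (snd z) = 0" using base(3)[of "fst z"] base(4)[of "snd z"] by auto
      moreover have "?C * (A * B) \<ge> 0"
        using A(1) order_trans[OF _ B[of 0]] by simp
      ultimately show ?thesis by (simp only: mult_zero_right norm_zero)
    next
      case True
      obtain x y where z: "z = (x, y)" by (cases z)
      define P where "P = (1 + norm x) * (1 + norm y)"
      have P1: "P \<ge> 1 + norm x + norm y" by (simp add: P_def algebra_simps)
      then have P0: "P \<ge> 0" by (rule order_trans[rotated]) simp
      have "norm z \<le> norm x + norm y"
        unfolding z norm_Pair by (rule sqrt_sum_squares_le_sum) auto
      then have zP: "1 + norm z \<le> P" using P1 by simp
      have powr: "(y - x) powr s \<le> (1 + (q - p) powr s) * P ^ n"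
      proof (cases "s \<ge> 0")
        case s: True
        have "(y - x) powr s \<le> P powr s"
          using True P1 s assms z by (intro powr_mono2) auto
        also have "\<dots> \<le> P powr real n"
          using P1 by (intro powr_mono) (auto simp: n_def s)
        also have "\<dots> = P ^ n" using P1 by (intro powr_realpow) simp
        also have "\<dots> \<le> (1 + (q - p) powr s) * P ^ n"
          using P1 by (simp add: algebra_simps)
        finally show ?thesis .
      next
        case s: False
        have "(y - x) powr s \<le> (q - p) powr s"
          using True z s assms by (intro powr_mono2') auto
        also have "\<dots> \<le> (1 + (q - p) powr s) * 1" by simp
        also have "\<dots> \<le> (1 + (q - p) powr s) * P ^ n"
          using P1 by (intro mult_left_mono one_le_power) auto
        finally show ?thesis .
      qed
      have "(1 + norm z) ^ k * norm (of_real (c * (snd z - fst z) powr s) * (a (fst z) * b (snd z)))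
          = (1 + norm z) ^ k * (\<bar>c\<bar> * (y - x) powr s * (norm (a x) * norm (b y)))"
        by (simp add: z norm_mult abs_mult)
      also have "\<dots> \<le> P ^ k * (\<bar>c\<bar> * ((1 + (q - p) powr s) * P ^ n) * (norm (a x) * norm (b y)))"
        using zP powr P0
        by (intro mult_mono power_mono mult_left_mono mult_right_mono mult_nonneg_nonneg) auto
      also have "\<dots> = ?C * (((1 + norm x) ^ (k + n) * norm (a x)) * ((1 + norm y) ^ (k + n) * norm (b y)))"
        by (simp add: P_def power_mult_distrib power_add mult_ac)
      also have "\<dots> \<le> ?C * (A * B)"
        using A B by (intro mult_left_mono mult_mono) auto
      finally show ?thesis .
    qed
    then show ?case unfolding bdd_above_def by blast
  qed (rule bdd_above_decay_add)
qed

text \<open>The exponent 3/2 is chosen to cancel the kernel \<open>|x -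
  y|\<^sup>-\<^sup>1\<^sup>/\<^sup>2 |x - y|\<^sup>-\<^sup>1\<close> of the fractional
  divergence.\<close>

definition tensor_test :: "(real \<Rightarrow> complex) \<Rightarrow> (real \<Rightarrow> complex) \<Rightarrow> real \<times> real \<Rightarrow> complex" where
  "tensor_test a b = (\<lambda>(x, y). of_real (\<bar>x - y\<bar> powr (3/2)) * (a x * b y - a y * b x))"

context
  fixes a b :: "real \<Rightarrow> complex" and p q :: real
  assumes ab: "a \<in> schwartz" "b \<in> schwartz"
    and separated: "p < q" "\<And>x. x > p \<Longrightarrow> a x = 0" "\<And>y. y < q \<Longrightarrow> b y = 0"
begin

lemma tensor_test_schwartz_od: "tensor_test a b \<in> schwartz_od"
proof -
  \<comment> \<open>The two terms of the antisymmetrisation have disjoint supports; on each of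
    them the absolute value can be dropped.\<close>
  define K where "K = (\<lambda>z. complex_of_real (1 * (snd z - fst z) powr (3/2)) * (a (fst z) * b (snd z)))"
  have K: "K \<in> schwartz"
    unfolding K_def
    using separated_kernels_schwartz[OF separated(1)] separated_kernels.base[OF ab separated(2,3)] by blast
  have eq: "tensor_test a b = (\<lambda>z. K z - K (prod.swap z))"
  proof (intro ext, clarify)
    fix x y :: real
    have zero: "a x * b y = 0" if "y \<le> x" for x y
      using separated(1) separated(2)[of x] separated(3)[of y] that by (cases "x > p") auto
    show "tensor_test a b (x, y) = K (x, y) - K (prod.swap (x, y))"
    proof (cases x y rule: linorder_cases)
      case less
      then show ?thesis using zero[of x y] by (auto simp: tensor_test_def K_def)
    next
      case equal
      then show ?thesis by (simp add: tensor_test_def K_def)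
    next
      case greater
      then show ?thesis using zero[of y x] by (auto simp: tensor_test_def K_def)
    qed
  qed
  \<comment> \<open>The function vanishes in the whole strip of width \<open>q - p\<close> around
    the diagonal.\<close>
  have "partial_derivs bs (tensor_test a b) (z, z) = 0" for bs z
  proof (rule partial_derivs_eq_0_on_open)
    show "open {w :: real \<times> real. \<bar>fst w - snd w\<bar> < q - p}"
      by (intro open_Collect_less continuous_intros)
    show "(z, z) \<in> {w. \<bar>fst w - snd w\<bar> < q - p}" using separated(1) by simp
    fix w :: "real \<times> real" assume w: "w \<in> {w. \<bar>fst w - snd w\<bar> < q - p}"
    obtain x y where xy: "w = (x, y)" by (cases w)
    have "a x * b y = 0" "a y * b x = 0"
      using w separated(2)[of x] separated(3)[of y] separated(2)[of y] separated(3)[of x]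
      by (cases "x > p"; cases "y > p"; force simp: xy)+
    then show "tensor_test a b w = 0" by (auto simp: tensor_test_def xy)
  qed
  moreover have "tensor_test a b \<in> schwartz"
    unfolding eq by (intro schwartz_diff K schwartz_swap)
  moreover have "tensor_test a b (x, y) = - tensor_test a b (y, x)" for x y
    by (simp add: tensor_test_def abs_minus_commute algebra_simps)
  ultimately show ?thesis
    unfolding schwartz_od_def by (intro CollectI conjI allI) assumption+
qed

lemma div_half_tensor_test:
  "div_half (tensor_test a b) = (\<lambda>x. 2 * (LINT y|lborel. b y) * a x - 2 * (LINT y|lborel. a y) * b x)"
proof
  fix x
  have eq: "2 * tensor_test a b (x, y) / of_real (\<bar>x - y\<bar> powr (1/2)) / of_real \<bar>x - y\<bar>
      = 2 * a x * b y - 2 * b x * a y" for y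
  proof (cases "x = y")
    case True
    have "a y * b y = 0"
      using separated(1) separated(2)[of y] separated(3)[of y] by (cases "y > p") auto
    then show ?thesis using True by (auto simp: tensor_test_def)
  next
    case False
    define d where "d = \<bar>x - y\<bar>"
    have d: "d > 0" using False by (simp add: d_def)
    have "d powr (3/2) = d powr (1/2) * d"
      using powr_add[of d "1/2" 1] d by simp
    then have "2 * (of_real (d powr (3/2)) * (a x * b y - a y * b x)) / of_real (d powr (1/2)) / of_real d
        = 2 * (a x * b y - a y * b x)"
      using d by (simp only: of_real_mult) simp
    then show ?thesis
      unfolding tensor_test_def d_def[symmetric] split_conv by (simp add: algebra_simps)
  qed
  have [measurable]: "a \<in> borel_measurable borel" "b \<in> borel_measurable borel"
    using ab by (auto intro: schwartz_borel)
  have "div_half (tensor_test a b) x = (LINT y|lborel. 2 * a x * b y - 2 * b x * a y)"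
    unfolding div_half_def eq by (rule integral_completion) simp
  also have "\<dots> = 2 * a x * (LINT y|lborel. b y) - 2 * b x * (LINT y|lborel. a y)"
    using ab by (simp add: schwartz_integrable)
  finally show "div_half (tensor_test a b) x
      = 2 * (LINT y|lborel. b y) * a x - 2 * (LINT y|lborel. a y) * b x"
    by (simp add: algebra_simps)
qed

end


section \<open>From the distribution to a function\<close>

text \<open>Fubini's theorem is used for products of Borel measures, so integrands are first
  replaced by Borel measurable ones.\<close>

lemma lebesgue_integrable_borel_version:
  fixes f :: "'a::euclidean_space \<Rightarrow> complex"
  assumes "integrable lebesgue f"
  obtains g where "integrable lborel g" "AE x in lebesgue. f x = g x"
proof -
  have [measurable]: "f \<in> borel_measurable lebesgue" using assms by (rule borel_measurable_integrable)
  obtain r where r[measurable]: "r \<in> borel_measurable lborel" "AE x in lborel. Re (f x) = r x"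
    using completion_ex_borel_measurable_real[of "\<lambda>x. Re (f x)" lborel] by auto
  obtain i where i[measurable]: "i \<in> borel_measurable lborel" "AE x in lborel. Im (f x) = i x"
    using completion_ex_borel_measurable_real[of "\<lambda>x. Im (f x)" lborel] by auto
  define g where "g x = Complex (r x) (i x)" for x
  have g: "g \<in> borel_measurable lborel"
    unfolding g_def Complex_eq by measurable
  have "AE x in lborel. f x = g x"
    using r(2) i(2) by eventually_elim (simp add: g_def complex_eq_iff)
  then have ae: "AE x in lebesgue. f x = g x" by (rule AE_completion)
  have "integrable lebesgue g"
    using assms ae g by (subst integrable_cong_AE[of _ _ f]) (auto intro: measurable_completion)
  then have "integrable lborel g" using g by (simp add: integrable_completion)
  then show thesis using ae by (rule that)
qed

lemma borel_measurable_fst_snd [measurable]: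
  "(fst :: real \<times> real \<Rightarrow> real) \<in> borel_measurable borel"
  "(snd :: real \<times> real \<Rightarrow> real) \<in> borel_measurable borel"
  by (intro borel_measurable_continuous_onI continuous_intros)+

text \<open>The factor that turns \<open>V(x, y) = F(x, y) / |x - y|\<close> back into the
  difference \<open>u(x) - u(y) = F(x, y) |x - y|\<^sup>1\<^sup>/\<^sup>2\<close>.\<close>

definition kern :: "real \<times> real \<Rightarrow> complex" where
  "kern z = of_real (\<bar>fst z - snd z\<bar> powr (3/2))"

lemma kern_borel [measurable]: "kern \<in> borel_measurable borel"
  unfolding kern_def[abs_def] by measurable

lemma kern_swap: "kern (prod.swap z) = kern z"
  by (simp add: kern_def abs_minus_commute)

lemma kern_le: "norm (kern (x, y)) * (weight x * weight y) \<le> 1"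
proof -
  let ?P = "(1 + \<bar>x\<bar>) * (1 + \<bar>y\<bar>)"
  have "?P = 1 + \<bar>x\<bar> + \<bar>y\<bar> + \<bar>x\<bar> * \<bar>y\<bar>" "\<bar>x\<bar> * \<bar>y\<bar> \<ge> 0" by (auto simp: algebra_simps)
  then have P: "?P \<ge> 1" "\<bar>x - y\<bar> \<le> ?P" by linarith+
  have "\<bar>x - y\<bar> powr (3/2) \<le> ?P powr (3/2)" using P by (intro powr_mono2) auto
  also have "\<dots> \<le> ?P powr 2" using P by (intro powr_mono) auto
  also have "\<dots> = ?P\<^sup>2" using P by simp
  finally have "norm (kern (x, y)) * (weight x * weight y) \<le> ?P\<^sup>2 * (weight x * weight y)"
    by (intro mult_right_mono) (auto simp: kern_def weight_def)
  also have "\<dots> = 1"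
  proof -
    have "1 + \<bar>x\<bar> \<noteq> 0" "1 + \<bar>y\<bar> \<noteq> 0" by linarith+
    then show ?thesis by (simp add: weight_def power_mult_distrib)
  qed
  finally show ?thesis .
qed

lemma integrable_kern_mult:
  fixes V :: "real \<times> real \<Rightarrow> complex" and a b :: "real \<Rightarrow> complex"
  assumes V: "integrable lborel V"
    and [measurable]: "a \<in> borel_measurable borel" "b \<in> borel_measurable borel"
    and A: "\<And>x. norm (a x) \<le> A * weight x" and B: "\<And>x. norm (b x) \<le> B * weight x"
  shows "integrable lborel (\<lambda>z. V z * (kern z * (a (fst z) * b (snd z))))"
proof (rule Bochner_Integration.integrable_bound[of _ "\<lambda>z. norm (V z) * (A * B)"])
  have [measurable]: "V \<in> borel_measurable borel"
    using V borel_measurable_integrable by fastforce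
  have "0 \<le> A * weight 0" using A[of 0] norm_ge_zero order_trans by blast
  then have A0: "A \<ge> 0" using weight_pos[of 0] by (simp add: zero_le_mult_iff)
  have "0 \<le> B * weight 0" using B[of 0] norm_ge_zero order_trans by blast
  then have B0: "B \<ge> 0" using weight_pos[of 0] by (simp add: zero_le_mult_iff)
  show "AE z in lborel. norm (V z * (kern z * (a (fst z) * b (snd z)))) \<le> norm (norm (V z) * (A * B))"
  proof (rule AE_I2)
    fix z :: "real \<times> real"
    obtain x y where z: "z = (x, y)" by (cases z)
    have "norm (kern z * (a x * b y)) \<le> norm (kern z) * ((A * weight x) * (B * weight y))"
      unfolding norm_mult by (intro mult_left_mono mult_mono A B) (use A0 weight_pos[of x] in auto)
    also have "\<dots> = norm (kern z) * (weight x * weight y) * (A * B)" by simp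
    also have "\<dots> \<le> 1 * (A * B)"
      unfolding z by (intro mult_right_mono kern_le) (use A0 B0 in auto)
    finally show "norm (V z * (kern z * (a (fst z) * b (snd z)))) \<le> norm (norm (V z) * (A * B))"
      using A0 B0 by (simp add: z norm_mult mult_left_mono)
  qed
  show "integrable lborel (\<lambda>z. norm (V z) * (A * B))" using V by simp
  show "(\<lambda>z. V z * (kern z * (a (fst z) * b (snd z)))) \<in> borel_measurable lborel" by measurable
qed

lemma integrable_kern_schwartz:
  fixes V :: "real \<times> real \<Rightarrow> complex" and a b :: "real \<Rightarrow> complex"
  assumes V: "integrable lborel V" and a: "a \<in> schwartz" and b: "b \<in> schwartz"
  shows "integrable lborel (\<lambda>z. V z * (kern z * (a (fst z) * b (snd z))))"
proof -
  obtain A B where "\<And>x. norm (a x) \<le> A * weight x" "\<And>x. norm (b x) \<le> B * weight x"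
    using schwartz_weight_bound[OF a] schwartz_weight_bound[OF b] by metis
  then show ?thesis
    by (rule integrable_kern_mult[OF V schwartz_borel[OF a] schwartz_borel[OF b]])
qed

lemma lborel_integral_swap:
  fixes f :: "real \<times> real \<Rightarrow> complex"
  assumes "f \<in> borel_measurable borel"
  shows "(LINT z|lborel. f (prod.swap z)) = (LINT z|lborel. f z)"
proof -
  have "integral\<^sup>L (lborel \<Otimes>\<^sub>M lborel) (\<lambda>(x, y). f (y, x)) = integral\<^sup>L (lborel \<Otimes>\<^sub>M lborel) f"
    by (rule lborel_pair.integral_product_swap) (use assms in \<open>simp add: lborel_prod\<close>)
  then show ?thesis by (simp add: lborel_prod case_prod_unfold prod.swap_def)
qed

lemma lborel_integrable_swap:
  fixes f :: "real \<times> real \<Rightarrow> 'b::{banach, second_countable_topology}"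
  assumes "integrable lborel f"
  shows "integrable lborel (\<lambda>z. f (prod.swap z))"
  using lborel_pair.integrable_product_swap[of f] assms
  by (simp add: lborel_prod case_prod_unfold prod.swap_def)

text \<open>The weak form of \<open>u(x) - u(y) = V(x, y) |x - y|\<^sup>3\<^sup>/\<^sup>2\<close>,
  tested only away from the diagonal and with \<open>x\<close> to the left of
  \<open>y\<close>.\<close>

definition weak_difference ::
    "((real \<Rightarrow> complex) \<Rightarrow> complex) \<Rightarrow> (real \<times> real \<Rightarrow> complex) \<Rightarrow> bool" where
  "weak_difference u V \<longleftrightarrow> (\<forall>a\<in>schwartz. \<forall>b\<in>schwartz. \<forall>p q.
    p < q \<longrightarrow> (\<forall>x>p. a x = 0) \<longrightarrow> (\<forall>y<q. b y = 0) \<longrightarrow>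
      u a * (LINT y|lborel. b y) - u b * (LINT x|lborel. a x)
        = (LINT z|lborel. V z * (kern z * (a (fst z) * b (snd z)))))"

text \<open>The function \<open>V\<close> is the antisymmetric part of a Borel version of
  \<open>F(x, y) / |x - y|\<close>. Antisymmetrisation does not increase the norm, and it folds
  the two terms of the test function into one.\<close>

lemma d_half_weak_difference:
  assumes u: "u \<in> tempered_distributions" and F: "F \<in> L1_od"
    and eq: "d_half u = od_distribution F"
  obtains V where "integrable lborel V" "(LINT z|lborel. norm (V z)) \<le> L1_od_norm F"
    "\<And>z. V (prod.swap z) = - V z" "weak_difference u V"
proof -
  define W0 where "W0 z = F z / of_real \<bar>fst z - snd z\<bar>" for z
  have [measurable]: "F \<in> borel_measurable lebesgue" using F by (simp add: L1_od_def)
  have norm_W0: "(\<lambda>(x, y). norm (F (x, y)) / \<bar>x - y\<bar>) = (\<lambda>z. norm (W0 z))"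
    by (auto simp: W0_def norm_divide)
  have [measurable]: "(\<lambda>z::real \<times> real. complex_of_real \<bar>fst z - snd z\<bar>) \<in> borel_measurable lebesgue"
    by (intro measurable_completion) measurable
  have "W0 \<in> borel_measurable lebesgue" unfolding W0_def[abs_def] by measurable
  moreover have "integrable lebesgue (\<lambda>z. norm (W0 z))"
    using F by (simp add: L1_od_def norm_W0)
  ultimately have "integrable lebesgue W0" by (simp add: integrable_norm_iff)
  then obtain W where W: "integrable lborel W" and ae: "AE z in lebesgue. W0 z = W z"
    by (rule lebesgue_integrable_borel_version)
  have [measurable]: "W \<in> borel_measurable borel"
    using W borel_measurable_integrable by fastforce
  have norm_F: "L1_od_norm F = (LINT z|lborel. norm (W z))"
  proof -
    have "L1_od_norm F = (LINT z|lebesgue. norm (W0 z))"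
      by (simp add: L1_od_norm_def norm_W0)
    also have "\<dots> = (LINT z|lebesgue. norm (W z))"
      by (rule integral_cong_AE) (use ae \<open>W0 \<in> _\<close> in \<open>auto intro: measurable_completion\<close>)
    also have "\<dots> = (LINT z|lborel. norm (W z))"
      by (rule integral_completion) simp
    finally show ?thesis .
  qed
  define V where "V z = (W z - W (prod.swap z)) / 2" for z
  have V: "integrable lborel V"
    unfolding V_def[abs_def] by (intro integrable_divide Bochner_Integration.integrable_diff W lborel_integrable_swap)
  have "(LINT z|lborel. norm (V z)) \<le> (LINT z|lborel. (norm (W z) + norm (W (prod.swap z))) / 2)"
  proof (rule integral_mono)
    show "norm (V z) \<le> (norm (W z) + norm (W (prod.swap z))) / 2" for z
      using norm_triangle_ineq4[of "W z" "W (prod.swap z)"] by (simp add: V_def norm_divide)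
    show "integrable lborel (\<lambda>z. (norm (W z) + norm (W (prod.swap z))) / 2)"
      by (intro integrable_divide Bochner_Integration.integrable_add integrable_norm W lborel_integrable_swap)
  qed (use V in simp)
  also have "\<dots> = L1_od_norm F"
  proof -
    have "complex_of_real (LINT z|lborel. norm (W (prod.swap z))) = complex_of_real (LINT z|lborel. norm (W z))"
      using lborel_integral_swap[of "\<lambda>z. of_real (norm (W z))"] by simp
    then have swap: "(LINT z|lborel. norm (W (prod.swap z))) = (LINT z|lborel. norm (W z))"
      by (simp only: of_real_eq_iff)
    show ?thesis
      unfolding norm_F integral_divide_zero
      by (subst Bochner_Integration.integral_add) (simp_all add: W lborel_integrable_swap swap)
  qed
  finally have norm_V: "(LINT z|lborel. norm (V z)) \<le> L1_od_norm F" .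
  have pairing: "u a * (LINT y|lborel. b y) - u b * (LINT x|lborel. a x)
        = (LINT z|lborel. V z * (kern z * (a (fst z) * b (snd z))))"
    if a: "a \<in> schwartz" and b: "b \<in> schwartz" and pq: "p < q"
      "\<And>x. x > p \<Longrightarrow> a x = 0" "\<And>y. y < q \<Longrightarrow> b y = 0" for a b p q
  proof -
    let ?G = "tensor_test a b" and ?A = "LINT x|lborel. a x" and ?B = "LINT y|lborel. b y"
    have [measurable]: "a \<in> borel_measurable borel" "b \<in> borel_measurable borel"
      using a b by (auto intro: schwartz_borel)
    have G: "?G \<in> schwartz_od" by (rule tensor_test_schwartz_od[OF a b pq])
    have G_eq: "?G z = kern z * (a (fst z) * b (snd z)) - kern z * (a (snd z) * b (fst z))" for z
      by (cases z) (simp add: tensor_test_def kern_def algebra_simps)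
    have [measurable]: "?G \<in> borel_measurable borel"
      using G by (auto simp: schwartz_od_def intro: schwartz_borel)
    have "d_half u ?G = u (\<lambda>x. 2 * ?B * a x + (- (2 * ?A)) * b x)"
      using G by (simp add: d_half_def div_half_tensor_test[OF a b pq])
    also have "\<dots> = 2 * ?B * u a + (- (2 * ?A)) * u b"
    proof -
      have add: "u (\<lambda>x. f x + g x) = u f + u g" if "f \<in> schwartz" "g \<in> schwartz" for f g
        using u that by (simp add: topological_dual_def)
      have cmult: "u (\<lambda>x. c * f x) = c * u f" if "f \<in> schwartz" for c f
        using u that by (simp add: topological_dual_def)
      show ?thesis
        by (simp only: add[OF schwartz_cmult[OF a] schwartz_cmult[OF b]] cmult[OF a] cmult[OF b])
    qed
    finally have lhs: "d_half u ?G = 2 * (u a * ?B - u b * ?A)" by (simp add: algebra_simps)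
    have "od_distribution F ?G = (LINT z|lebesgue. W0 z * ?G z)"
      using G by (simp add: od_distribution_def W0_def case_prod_unfold)
    also have "\<dots> = (LINT z|lebesgue. W z * ?G z)"
    proof (rule integral_cong_AE)
      have G': "?G \<in> borel_measurable lebesgue" and W': "W \<in> borel_measurable lebesgue"
        by (auto intro: measurable_completion)
      show "(\<lambda>z. W0 z * ?G z) \<in> borel_measurable lebesgue" "(\<lambda>z. W z * ?G z) \<in> borel_measurable lebesgue"
        using G' W' \<open>W0 \<in> _\<close> by measurable
      show "AE z in lebesgue. W0 z * ?G z = W z * ?G z" using ae by eventually_elim simp
    qed
    also have "\<dots> = (LINT z|lborel. W z * ?G z)" by (rule integral_completion) simp
    also have "\<dots> = (LINT z|lborel. W z * (kern z * (a (fst z) * b (snd z))))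
        - (LINT z|lborel. W z * (kern z * (b (fst z) * a (snd z))))"
      unfolding G_eq right_diff_distrib mult.commute[of "a (snd _)"]
      by (intro Bochner_Integration.integral_diff integrable_kern_schwartz W a b)
    also have "(LINT z|lborel. W z * (kern z * (b (fst z) * a (snd z))))
        = (LINT z|lborel. W (prod.swap z) * (kern z * (a (fst z) * b (snd z))))"
      by (subst lborel_integral_swap[symmetric])
        (auto intro!: Bochner_Integration.integral_cong simp: kern_swap mult_ac)
    also have "(LINT z|lborel. W z * (kern z * (a (fst z) * b (snd z))))
        - (LINT z|lborel. W (prod.swap z) * (kern z * (a (fst z) * b (snd z))))
        = (LINT z|lborel. W z * (kern z * (a (fst z) * b (snd z)))
            - W (prod.swap z) * (kern z * (a (fst z) * b (snd z))))"
      by (intro Bochner_Integration.integral_diff[symmetric] integrable_kern_schwartz W a b lborel_integrable_swap)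
    also have "\<dots> = (LINT z|lborel. 2 * (V z * (kern z * (a (fst z) * b (snd z)))))"
      by (rule Bochner_Integration.integral_cong) (auto simp: V_def algebra_simps)
    also have "\<dots> = 2 * (LINT z|lborel. V z * (kern z * (a (fst z) * b (snd z))))" by simp
    finally have "2 * (u a * ?B - u b * ?A) = 2 * (LINT z|lborel. V z * (kern z * (a (fst z) * b (snd z))))"
      using lhs eq by (simp only:)
    then show ?thesis by (simp only: mult_cancel_left) simp
  qed
  have "V (prod.swap z) = - V z" for z by (simp add: V_def minus_divide_left)
  moreover have "weak_difference u V"
    unfolding weak_difference_def using pairing by blast
  ultimately show thesis using that[OF V norm_V] by blast
qed

lemma normalized_bump:
  assumes "p < q"
  obtains \<beta> :: "real \<Rightarrow> complex" where "\<beta> \<in> schwartz" "(LINT x|lborel. \<beta> x) = 1"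
    "\<And>x. x \<le> p \<or> q \<le> x \<Longrightarrow> \<beta> x = 0"
proof -
  let ?b = "bump 1 p q"
  have b: "(\<lambda>x. complex_of_real (?b x)) \<in> schwartz" by (rule bump_schwartz) simp
  have int: "integrable lborel ?b" using integrable_Re[OF schwartz_integrable[OF b]] by simp
  define c where "c = (LINT x|lborel. ?b x)"
  have "c \<noteq> 0"
  proof
    assume "c = 0"
    then have "AE x in lborel. ?b x = 0"
      using integral_nonneg_eq_0_iff_AE[OF int] by (simp add: c_def bump_nonneg)
    then have "AE x in lborel. x \<notin> {p<..<q}"
      by eventually_elim (use bump_pos[of 1 p _ q] in force)
    then have "emeasure lborel {p<..<q} = 0"
      by (subst (asm) AE_iff_measurable[of "{p<..<q}"]) auto
    then show False using assms by simp
  qed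
  show thesis
  proof (rule that)
    show "(\<lambda>x. (1 / of_real c) * of_real (?b x)) \<in> schwartz" by (rule schwartz_cmult[OF b])
    show "(LINT x|lborel. (1 / of_real c) * complex_of_real (?b x)) = 1"
      using \<open>c \<noteq> 0\<close> by (simp add: c_def)
    show "(1 / of_real c) * complex_of_real (?b x) = 0" if "x \<le> p \<or> q \<le> x" for x
      using bump_eq_0[of 1 x p q] that by simp
  qed
qed

text \<open>The average in \<open>y\<close> of the difference \<open>u(x) - u(y)\<close> with
  respect to the density \<open>\<beta>\<close>. Adding the number \<open>u(\<beta>)\<close>
  therefore recovers \<open>u(x)\<close> when \<open>\<integral>\<beta> = 1\<close>.\<close>

definition potential :: "(real \<times> real \<Rightarrow> complex) \<Rightarrow> (real \<Rightarrow> complex) \<Rightarrow> real \<Rightarrow> complex" where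
  "potential V \<beta> x = (LINT y|lborel. V (x, y) * (kern (x, y) * \<beta> y))"

lemma
  assumes V: "integrable lborel V" and \<beta>: "\<beta> \<in> schwartz"
    and [measurable]: "a \<in> borel_measurable borel" and A: "\<And>x. norm (a x) \<le> A * weight x"
  shows potential_integrable: "integrable lborel (\<lambda>x. a x * potential V \<beta> x)"
    and integral_potential: "(LINT x|lborel. a x * potential V \<beta> x)
      = (LINT z|lborel. V z * (kern z * (a (fst z) * \<beta> (snd z))))"
proof -
  obtain B where "\<And>x. norm (\<beta> x) \<le> B * weight x"
    using schwartz_weight_bound[OF \<beta>] by metis
  then have int: "integrable (lborel \<Otimes>\<^sub>M lborel) (\<lambda>z. V z * (kern z * (a (fst z) * \<beta> (snd z))))"
    unfolding lborel_prod by (intro integrable_kern_mult[OF V _ _ A]) (use \<beta> schwartz_borel in auto)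
  have eq: "a x * potential V \<beta> x = (LINT y|lborel. V (x, y) * (kern (x, y) * (a x * \<beta> y)))" for x
    unfolding potential_def integral_mult_right_zero[symmetric]
    by (rule Bochner_Integration.integral_cong) auto
  show "integrable lborel (\<lambda>x. a x * potential V \<beta> x)"
    using lborel_pair.integrable_fst'[OF int] by (simp add: eq)
  show "(LINT x|lborel. a x * potential V \<beta> x)
      = (LINT z|lborel. V z * (kern z * (a (fst z) * \<beta> (snd z))))"
    using lborel_pair.integral_fst'[OF int] by (simp add: eq lborel_prod)
qed

lemma potential_borel:
  assumes [measurable]: "V \<in> borel_measurable borel" "\<beta> \<in> borel_measurable borel"
  shows "potential V \<beta> \<in> borel_measurable borel"
proof -
  have [measurable]: "V \<in> borel_measurable (lborel \<Otimes>\<^sub>M lborel)" "kern \<in> borel_measurable (lborel \<Otimes>\<^sub>M lborel)"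
    by (simp_all add: lborel_prod)
  have "potential V \<beta> \<in> borel_measurable lborel"
    unfolding potential_def[abs_def] by measurable
  then show ?thesis by simp
qed

text \<open>On functions supported away from a fixed normalised bump \<open>\<beta>\<close>, the
  weak difference formula with \<open>\<beta>\<close> as second entry says that \<open>u\<close>
  is integration against \<open>u(\<beta>) + potential V \<beta>\<close>. The bumps
  \<open>\<beta>0\<close> on \<open>[-1, 0]\<close> and \<open>\<beta>1\<close> on \<open>[3,
  4]\<close> serve the half-lines \<open>x \<ge> 1\<close> and \<open>x \<le> 2\<close>, and the
  smooth step \<open>S\<close> splits every Schwartz function between these two.\<close>

lemma distribution_eq_function:
  fixes u :: "(real \<Rightarrow> complex) \<Rightarrow> complex"
  assumes u_add: "\<And>f g. f \<in> schwartz \<Longrightarrow> g \<in> schwartz \<Longrightarrow> u (\<lambda>x. f x + g x) = u f + u g"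
    and V: "integrable lborel V" "\<And>z. V (prod.swap z) = - V z"
    and diff: "weak_difference u V"
  obtains g where "g \<in> borel_measurable borel" "integrable lborel (\<lambda>x. weight x * norm (g x))"
    "\<And>\<phi>. \<phi> \<in> schwartz \<Longrightarrow> u \<phi> = (LINT x|lborel. g x * \<phi> x)"
proof -
  have [measurable]: "V \<in> borel_measurable borel"
    using V(1) borel_measurable_integrable by fastforce
  have "-1 < (0::real)" "3 < (4::real)" by simp_all
  obtain \<beta>0 :: "real \<Rightarrow> complex" where \<beta>0: "\<beta>0 \<in> schwartz" "(LINT x|lborel. \<beta>0 x) = 1"
    "\<And>x. x \<le> - 1 \<or> 0 \<le> x \<Longrightarrow> \<beta>0 x = 0"
    by (rule normalized_bump[OF \<open>-1 < (0::real)\<close>]) (rule that)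
  obtain \<beta>1 :: "real \<Rightarrow> complex" where \<beta>1: "\<beta>1 \<in> schwartz" "(LINT x|lborel. \<beta>1 x) = 1"
    "\<And>x. x \<le> 3 \<or> 4 \<le> x \<Longrightarrow> \<beta>1 x = 0"
    by (rule normalized_bump[OF \<open>3 < (4::real)\<close>]) (rule that)
  obtain S :: "real \<Rightarrow> complex" where S: "S \<in> bounded_smooth" "\<And>x. x \<le> 1 \<Longrightarrow> S x = 0" "\<And>x. x \<ge> 2 \<Longrightarrow> S x = 1"
    by (rule smooth_step) (rule that)
  define h where "h \<beta> x = u \<beta> + potential V \<beta> x" for \<beta> x
  have h_borel [measurable]: "h \<beta> \<in> borel_measurable borel" if "\<beta> \<in> schwartz" for \<beta>
    unfolding h_def[abs_def] using potential_borel schwartz_borel[OF that] by measurable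
  have h_weight: "integrable lborel (\<lambda>x. a x * h \<beta> x)"
    if "\<beta> \<in> schwartz" "a \<in> borel_measurable borel" "\<And>x. norm (a x) \<le> A * weight x" for \<beta> a A
  proof -
    have "integrable lborel a"
      by (rule Bochner_Integration.integrable_bound[of _ "\<lambda>x. A * weight x"])
        (use that weight_integrable order_trans[OF that(3) abs_ge_self] in auto)
    then show ?thesis
      unfolding h_def distrib_left
      by (intro Bochner_Integration.integrable_add integrable_mult_left potential_integrable[OF V(1) that])
  qed
  have h_schwartz: "integrable lborel (\<lambda>x. a x * h \<beta> x)"
    "(LINT x|lborel. a x * h \<beta> x) = u \<beta> * (LINT x|lborel. a x)
      + (LINT z|lborel. V z * (kern z * (a (fst z) * \<beta> (snd z))))"
    if \<beta>: "\<beta> \<in> schwartz" and a: "a \<in> schwartz" for \<beta> a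
  proof -
    obtain A where A: "\<And>x. norm (a x) \<le> A * weight x"
      using schwartz_weight_bound[OF a] by metis
    note pot = potential_integrable[OF V(1) \<beta> schwartz_borel[OF a] A]
      integral_potential[OF V(1) \<beta> schwartz_borel[OF a] A]
    show "integrable lborel (\<lambda>x. a x * h \<beta> x)"
      by (rule h_weight[OF \<beta> schwartz_borel[OF a] A])
    show "(LINT x|lborel. a x * h \<beta> x) = u \<beta> * (LINT x|lborel. a x)
      + (LINT z|lborel. V z * (kern z * (a (fst z) * \<beta> (snd z))))"
      unfolding h_def distrib_left
      using pot schwartz_integrable[OF a]
      by (subst Bochner_Integration.integral_add) (auto simp: mult.commute)
  qed
  have left: "u a = (LINT x|lborel. a x * h \<beta>1 x)" if a: "a \<in> schwartz" "\<And>x. x > 2 \<Longrightarrow> a x = 0" for a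
  proof -
    have "u a * (LINT y|lborel. \<beta>1 y) - u \<beta>1 * (LINT x|lborel. a x)
        = (LINT z|lborel. V z * (kern z * (a (fst z) * \<beta>1 (snd z))))"
      by (rule diff[unfolded weak_difference_def, rule_format, OF a(1) \<beta>1(1), of 2 3])
        (use a(2) \<beta>1(3) in auto)
    then show ?thesis using h_schwartz(2)[OF \<beta>1(1) a(1)] \<beta>1(2) by (simp add: algebra_simps)
  qed
  have right: "u b = (LINT x|lborel. b x * h \<beta>0 x)" if b: "b \<in> schwartz" "\<And>x. x < 1 \<Longrightarrow> b x = 0" for b
  proof -
    have "u \<beta>0 * (LINT y|lborel. b y) - u b * (LINT x|lborel. \<beta>0 x)
        = (LINT z|lborel. V z * (kern z * (\<beta>0 (fst z) * b (snd z))))"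
      by (rule diff[unfolded weak_difference_def, rule_format, OF \<beta>0(1) b(1), of 0 1])
        (use b(2) \<beta>0(3) in auto)
    also have "\<dots> = (LINT z|lborel. - (V z * (kern z * (b (fst z) * \<beta>0 (snd z)))))"
    proof -
      have [measurable]: "\<beta>0 \<in> borel_measurable borel" "b \<in> borel_measurable borel"
        using \<beta>0(1) b(1) by (auto intro: schwartz_borel)
      show ?thesis
        by (subst lborel_integral_swap[symmetric])
          (auto intro!: Bochner_Integration.integral_cong simp: kern_swap mult_ac V(2))
    qed
    finally show ?thesis
      using h_schwartz(2)[OF \<beta>0(1) b(1)] \<beta>0(2) by (simp add: algebra_simps)
  qed
  define g where "g x = (1 - S x) * h \<beta>1 x + S x * h \<beta>0 x" for x
  have [measurable]: "S \<in> borel_measurable borel"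
    by (intro borel_measurable_continuous_onI differentiable_imp_continuous_on)
      (simp add: differentiable_on_def bounded_smooth_differentiable[OF S(1)])
  have [measurable]: "h \<beta>0 \<in> borel_measurable borel" "h \<beta>1 \<in> borel_measurable borel"
    using \<beta>0(1) \<beta>1(1) by measurable
  show thesis
  proof (rule that)
    show "g \<in> borel_measurable borel" unfolding g_def[abs_def] by measurable
    obtain M where M: "\<And>x. norm (S x) \<le> M"
      using S(1) by (fastforce simp: bounded_smooth_def bdd_above_def dest!: spec[of _ "[]"])
    have "integrable lborel (\<lambda>x. (of_real (weight x) * (1 - S x)) * h \<beta>1 x)"
    proof (rule h_weight[OF \<beta>1(1), where A = "1 + M"])
      show "norm (of_real (weight x) * (1 - S x)) \<le> (1 + M) * weight x" for x
      proof -
        have "norm (1 - S x) \<le> 1 + M" using norm_triangle_ineq4[of 1 "S x"] M[of x] by simp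
        then show ?thesis using weight_pos[of x] by (simp add: norm_mult mult.commute mult_left_mono)
      qed
    qed measurable
    moreover have "integrable lborel (\<lambda>x. (of_real (weight x) * S x) * h \<beta>0 x)"
      by (rule h_weight[OF \<beta>0(1), where A = M])
        (use M weight_pos in \<open>auto simp: norm_mult mult.commute mult_left_mono less_imp_le\<close>)
    ultimately have "integrable lborel (\<lambda>x. (of_real (weight x) * (1 - S x)) * h \<beta>1 x
        + (of_real (weight x) * S x) * h \<beta>0 x)"
      by (rule Bochner_Integration.integrable_add)
    then have "integrable lborel (\<lambda>x. norm (of_real (weight x) * g x))"
      by (intro integrable_norm) (simp add: g_def algebra_simps)
    then show "integrable lborel (\<lambda>x. weight x * norm (g x))"
      using weight_pos by (simp add: norm_mult less_imp_le)
    fix \<phi> :: "real \<Rightarrow> complex" assume \<phi>: "\<phi> \<in> schwartz"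
    have \<phi>S: "(\<lambda>x. \<phi> x * S x) \<in> schwartz" by (rule schwartz_mult[OF \<phi> S(1)])
    have \<phi>1S: "(\<lambda>x. \<phi> x - \<phi> x * S x) \<in> schwartz" by (rule schwartz_diff[OF \<phi> \<phi>S])
    have "u \<phi> = u (\<lambda>x. (\<phi> x - \<phi> x * S x) + \<phi> x * S x)" by simp
    also have "\<dots> = u (\<lambda>x. \<phi> x - \<phi> x * S x) + u (\<lambda>x. \<phi> x * S x)"
      by (rule u_add[OF \<phi>1S \<phi>S])
    also have "\<dots> = (LINT x|lborel. (\<phi> x - \<phi> x * S x) * h \<beta>1 x) + (LINT x|lborel. (\<phi> x * S x) * h \<beta>0 x)"
      by (subst left[OF \<phi>1S], use S in simp) (subst right[OF \<phi>S], use S in simp_all)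
    also have "\<dots> = (LINT x|lborel. (\<phi> x - \<phi> x * S x) * h \<beta>1 x + (\<phi> x * S x) * h \<beta>0 x)"
      by (intro Bochner_Integration.integral_add[symmetric] h_schwartz(1) \<beta>0(1) \<beta>1(1) \<phi>S \<phi>1S)
    also have "\<dots> = (LINT x|lborel. g x * \<phi> x)"
      by (rule Bochner_Integration.integral_cong) (auto simp: g_def algebra_simps)
    finally show "u \<phi> = (LINT x|lborel. g x * \<phi> x)" .
  qed
qed


section \<open>Averages over adjacent intervals\<close>

lemma weight_ge_on_interval:
  assumes "x \<in> {p..q}"
  shows "1 \<le> (1 + \<bar>p\<bar> + \<bar>q\<bar>)\<^sup>2 * weight x"
proof -
  have "(1 + \<bar>x\<bar>)\<^sup>2 \<le> (1 + \<bar>p\<bar> + \<bar>q\<bar>)\<^sup>2" using assms by (intro power_mono) auto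
  moreover have "(1 + \<bar>x\<bar>)\<^sup>2 > 0" by (simp add: add_pos_nonneg)
  ultimately show ?thesis by (simp add: weight_def)
qed

lemma weighted_set_integrable:
  fixes g :: "real \<Rightarrow> complex"
  assumes [measurable]: "g \<in> borel_measurable borel" and g: "integrable lborel (\<lambda>x. weight x * norm (g x))"
    and [measurable]: "S \<in> sets borel" and S: "S \<subseteq> {p..q}"
  shows "set_integrable lborel S g"
  unfolding set_integrable_def
proof (rule Bochner_Integration.integrable_bound)
  let ?c = "(1 + \<bar>p\<bar> + \<bar>q\<bar>)\<^sup>2"
  show "integrable lborel (\<lambda>x. ?c * (weight x * norm (g x)))" using g by simp
  show "AE x in lborel. norm (indicat_real S x *\<^sub>R g x) \<le> norm (?c * (weight x * norm (g x)))"
  proof (rule AE_I2)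
    fix x
    show "norm (indicat_real S x *\<^sub>R g x) \<le> norm (?c * (weight x * norm (g x)))"
    proof (cases "x \<in> S")
      case True
      then have "1 * norm (g x) \<le> (?c * weight x) * norm (g x)"
        using S by (intro mult_right_mono weight_ge_on_interval) auto
      also have "\<dots> \<le> \<bar>?c * (weight x * norm (g x))\<bar>" by (simp add: mult.assoc)
      finally show ?thesis using True by simp
    qed simp
  qed
qed measurable

lemma bump_integral_tendsto:
  fixes g :: "real \<Rightarrow> complex"
  assumes [measurable]: "g \<in> borel_measurable borel" and g: "integrable lborel (\<lambda>x. weight x * norm (g x))"
    and "p < q"
  shows "(\<lambda>n. LINT x|lborel. g x * of_real (bump (Suc n) (p + 1 / Suc n) q x))
    \<longlonglongrightarrow> (LINT x:{p..<q}|lborel. g x)"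
proof -
  have "(LINT x:{p..<q}|lborel. g x) = (LINT x|lborel. g x * of_real (indicator {p<..<q} x))"
    unfolding set_lebesgue_integral_def
  proof (rule integral_cong_AE)
    show "AE x in lborel. indicat_real {p..<q} x *\<^sub>R g x = g x * of_real (indicator {p<..<q} x)"
      using AE_lborel_singleton[of p] by eventually_elim (auto simp: indicator_def)
  qed measurable
  moreover have "(\<lambda>n. LINT x|lborel. g x * of_real (bump (Suc n) (p + 1 / Suc n) q x))
    \<longlonglongrightarrow> (LINT x|lborel. g x * of_real (indicator {p<..<q} x))"
  proof (rule integral_dominated_convergence)
    show "integrable lborel (\<lambda>x. norm (indicat_real {p..q} x *\<^sub>R g x))"
      using weighted_set_integrable[OF assms(1,2), of "{p..q}" p q]
      unfolding set_integrable_def by (intro integrable_norm) simp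
    show "AE x in lborel. (\<lambda>n. g x * of_real (bump (Suc n) (p + 1 / Suc n) q x))
        \<longlonglongrightarrow> g x * of_real (indicator {p<..<q} x)"
      by (intro AE_I2 tendsto_intros bump_tendsto_indicator assms)
    show "AE x in lborel. norm (g x * of_real (bump (Suc n) (p + 1 / Suc n) q x))
        \<le> norm (indicat_real {p..q} x *\<^sub>R g x)" for n
    proof (rule AE_I2)
      fix x
      have "\<bar>bump (Suc n) (p + 1 / Suc n) q x\<bar> \<le> indicat_real {p..q} x"
      proof (cases "x \<in> {p..q}")
        case False
        then have "x < p \<or> q < x" by auto
        moreover have "0 < 1 / real (Suc n)" by simp
        ultimately have "x \<le> p + 1 / Suc n \<or> q \<le> x" by linarith
        then show ?thesis using bump_eq_0[of "Suc n"] by simp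
      qed (simp add: bump_nonneg bump_le_1)
      then have "norm (g x) * \<bar>bump (Suc n) (p + 1 / Suc n) q x\<bar> \<le> norm (g x) * indicat_real {p..q} x"
        by (rule mult_left_mono) simp
      then show "norm (g x * of_real (bump (Suc n) (p + 1 / Suc n) q x)) \<le> norm (indicat_real {p..q} x *\<^sub>R g x)"
        by (simp add: norm_mult mult.commute)
    qed
  qed measurable
  ultimately show ?thesis by simp
qed

text \<open>Pass to the limit in the weak difference formula with bumps that tend to the
  indicators of the two intervals. On their product \<open>|x - y| \<le> 2 L\<close>, which bounds
  the factor \<open>kern\<close>.\<close>

lemma adjacent_interval_estimate:
  fixes g :: "real \<Rightarrow> complex"
  assumes [measurable]: "g \<in> borel_measurable borel" and g: "integrable lborel (\<lambda>x. weight x * norm (g x))"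
    and V: "integrable lborel V"
    and diff: "weak_difference (\<lambda>\<phi>. LINT x|lborel. g x * \<phi> x) V"
    and L: "L > 0"
  shows "norm ((LINT x:{c..<c+L}|lborel. g x) - (LINT x:{c+L..<c+2*L}|lborel. g x)) * L
    \<le> (2 * L) powr (3/2) * (LINT z|lborel. indicator ({c..<c+L} \<times> {c+L..<c+2*L}) z * norm (V z))"
proof -
  have [measurable]: "V \<in> borel_measurable borel"
    using V borel_measurable_integrable by fastforce
  \<comment> \<open>The support of \<open>b n\<close> starts at distance \<open>1/(n+1)\<close> to
    the right of that of \<open>a n\<close>.\<close>
  define a where "a n x = complex_of_real (bump (Suc n) (c + 1 / Suc n) (c + L) x)" for n x
  define b where "b n x = complex_of_real (bump (Suc n) (c + L + 1 / Suc n) (c + 2 * L) x)" for n x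
  define I where "I = {c<..<c+L}"
  define J where "J = {c+L<..<c+2*L}"
  have IJ [measurable]: "I \<in> sets borel" "J \<in> sets borel" by (auto simp: I_def J_def)
  let ?f = "\<lambda>z::real \<times> real. V z * (kern z * (of_real (indicator I (fst z)) * of_real (indicator J (snd z))))"
  have le: "c < c + L" "c + L < c + 2 * L" using L by auto
  have one: "integrable lborel (\<lambda>x. weight x * norm (1::complex))" using weight_integrable by simp
  have len: "(LINT x:{p..<q}|lborel. (1::complex)) = of_real (q - p)" if "p < q" for p q
    using that by (simp add: set_lebesgue_integral_def scaleR_conv_of_real)
  have lim_a: "(\<lambda>n. LINT x|lborel. a n x) \<longlonglongrightarrow> of_real L"
    using bump_integral_tendsto[of "\<lambda>_. 1", OF _ one le(1)] len[OF le(1)] by (simp add: a_def)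
  have lim_b: "(\<lambda>n. LINT x|lborel. b n x) \<longlonglongrightarrow> of_real L"
    using bump_integral_tendsto[of "\<lambda>_. 1", OF _ one le(2)] len[OF le(2)] by (simp add: b_def)
  have lim_ga: "(\<lambda>n. LINT x|lborel. g x * a n x) \<longlonglongrightarrow> (LINT x:{c..<c+L}|lborel. g x)"
    unfolding a_def by (rule bump_integral_tendsto[OF assms(1) g le(1)])
  have lim_gb: "(\<lambda>n. LINT x|lborel. g x * b n x) \<longlonglongrightarrow> (LINT x:{c+L..<c+2*L}|lborel. g x)"
    unfolding b_def by (rule bump_integral_tendsto[OF assms(1) g le(2)])
  have a0: "a n x = 0" if "x \<le> c \<or> c + L \<le> x" for n x
  proof -
    have "0 < 1 / real (Suc n)" by simp
    then have "x \<le> c + 1 / Suc n \<or> c + L \<le> x" using that by linarith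
    then show ?thesis using bump_eq_0[of "Suc n"] by (simp add: a_def)
  qed
  have b0: "b n x = 0" if "x \<le> c + L + 1 / Suc n \<or> c + 2 * L \<le> x" for n x
    using bump_eq_0[of "Suc n"] that by (simp add: b_def)
  have b0': "b n x = 0" if "x \<le> c + L \<or> c + 2 * L \<le> x" for n x
  proof -
    have "0 < 1 / real (Suc n)" by simp
    then have "x \<le> c + L + 1 / Suc n \<or> c + 2 * L \<le> x" using that by linarith
    then show ?thesis by (rule b0)
  qed
  have ab1: "norm (a n x) \<le> 1" "norm (b n x) \<le> 1" for n x
    by (simp_all add: a_def b_def bump_nonneg bump_le_1)
  have kern_bound: "norm (kern z) \<le> (2 * L) powr (3/2)" if "fst z \<in> {c..c+L}" "snd z \<in> {c+L..c+2*L}" for z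
  proof -
    have "\<bar>fst z - snd z\<bar> \<le> 2 * L" using that by auto
    then show ?thesis unfolding kern_def by (simp add: powr_mono2)
  qed
  have lim_V: "(\<lambda>n. LINT z|lborel. V z * (kern z * (a n (fst z) * b n (snd z)))) \<longlonglongrightarrow> (LINT z|lborel. ?f z)"
  proof (rule integral_dominated_convergence)
    show "integrable lborel (\<lambda>z. (2 * L) powr (3/2) * norm (V z))" using V by simp
    have ab_borel[measurable]: "a n \<in> borel_measurable borel" "b n \<in> borel_measurable borel" for n
      unfolding a_def[abs_def] b_def[abs_def] by measurable
    show "(\<lambda>z. V z * (kern z * (a n (fst z) * b n (snd z)))) \<in> borel_measurable lborel" for n
      by measurable
    show "?f \<in> borel_measurable lborel" by measurable
    show "AE z in lborel. (\<lambda>n. V z * (kern z * (a n (fst z) * b n (snd z)))) \<longlonglongrightarrow> ?f z"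
      unfolding a_def b_def I_def J_def
      by (intro AE_I2 tendsto_intros bump_tendsto_indicator le)
    show "AE z in lborel. norm (V z * (kern z * (a n (fst z) * b n (snd z)))) \<le> (2 * L) powr (3/2) * norm (V z)" for n
    proof (rule AE_I2)
      fix z :: "real \<times> real"
      show "norm (V z * (kern z * (a n (fst z) * b n (snd z)))) \<le> (2 * L) powr (3/2) * norm (V z)"
      proof (cases "fst z \<in> {c..c+L} \<and> snd z \<in> {c+L..c+2*L}")
        case True
        then have "norm (kern z) * (norm (a n (fst z)) * norm (b n (snd z))) \<le> (2 * L) powr (3/2) * (1 * 1)"
          by (intro mult_mono kern_bound ab1) auto
        then show ?thesis
          by (simp add: norm_mult mult.commute mult_left_mono)
      next
        case False
        then have "a n (fst z) * b n (snd z) = 0"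
          using a0[of "fst z" n] b0'[of "snd z" n] by auto
        then show ?thesis by (simp only: mult_zero_right norm_zero) simp
      qed
    qed
  qed
  have "(LINT x:{c..<c+L}|lborel. g x) * of_real L - (LINT x:{c+L..<c+2*L}|lborel. g x) * of_real L
      = (LINT z|lborel. ?f z)"
  proof (rule LIMSEQ_unique)
    show "(\<lambda>n. (LINT x|lborel. g x * a n x) * (LINT y|lborel. b n y)
        - (LINT x|lborel. g x * b n x) * (LINT x|lborel. a n x))
      \<longlonglongrightarrow> (LINT x:{c..<c+L}|lborel. g x) * of_real L - (LINT x:{c+L..<c+2*L}|lborel. g x) * of_real L"
      by (intro tendsto_intros lim_a lim_b lim_ga lim_gb)
    have "(LINT x|lborel. g x * a n x) * (LINT y|lborel. b n y)
        - (LINT x|lborel. g x * b n x) * (LINT x|lborel. a n x)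
        = (LINT z|lborel. V z * (kern z * (a n (fst z) * b n (snd z))))" for n
    proof (rule diff[unfolded weak_difference_def, rule_format])
      show "a n \<in> schwartz" "b n \<in> schwartz"
        unfolding a_def[abs_def] b_def[abs_def] by (auto intro!: bump_schwartz)
      show "c + L < c + L + 1 / Suc n" by simp
    qed (use a0 b0 in auto)
    then show "(\<lambda>n. (LINT x|lborel. g x * a n x) * (LINT y|lborel. b n y)
        - (LINT x|lborel. g x * b n x) * (LINT x|lborel. a n x)) \<longlonglongrightarrow> (LINT z|lborel. ?f z)"
      using lim_V by simp
  qed
  then have "((LINT x:{c..<c+L}|lborel. g x) - (LINT x:{c+L..<c+2*L}|lborel. g x)) * of_real L
      = (LINT z|lborel. ?f z)"
    by (simp only: left_diff_distrib)
  from arg_cong[OF this, of norm]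
  have "norm ((LINT x:{c..<c+L}|lborel. g x) - (LINT x:{c+L..<c+2*L}|lborel. g x)) * L
      = norm (LINT z|lborel. ?f z)"
    using L by (simp only: norm_mult norm_of_real abs_of_pos)
  also have "\<dots> \<le> (LINT z|lborel. norm (?f z))" by (rule integral_norm_bound)
  also have "\<dots> \<le> (LINT z|lborel. (2 * L) powr (3/2) * (indicator ({c..<c+L} \<times> {c+L..<c+2*L}) z * norm (V z)))"
  proof (rule integral_mono')
    have "integrable lborel (\<lambda>z. indicat_real ({c..<c+L} \<times> {c+L..<c+2*L}) z *\<^sub>R norm (V z))"
      by (intro integrable_mult_indicator) (use V in \<open>auto simp: borel_Times\<close>)
    then show "integrable lborel (\<lambda>z. (2 * L) powr (3/2) * (indicator ({c..<c+L} \<times> {c+L..<c+2*L}) z * norm (V z)))"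
      by simp
    fix z :: "real \<times> real"
    show "norm (?f z) \<le> (2 * L) powr (3/2) * (indicator ({c..<c+L} \<times> {c+L..<c+2*L}) z * norm (V z))"
    proof (cases "fst z \<in> I \<and> snd z \<in> J")
      case True
      then have "norm (kern z) \<le> (2 * L) powr (3/2)"
        by (intro kern_bound) (auto simp: I_def J_def)
      moreover have "z \<in> {c..<c+L} \<times> {c+L..<c+2*L}"
        using True by (cases z) (auto simp: I_def J_def)
      ultimately show ?thesis
        using True mult_left_mono[of "norm (kern z)" "(2 * L) powr (3/2)" "norm (V z)"]
        by (simp add: norm_mult mult.commute)
    qed auto
  qed simp
  finally show ?thesis by simp
qed


section \<open>Dyadic averages\<close>

text \<open>The index of the dyadic interval of length \<open>2\<^sup>-\<^sup>k\<close> containing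
  \<open>x\<close>; negative \<open>k\<close> give the long intervals.\<close>

definition dyad :: "int \<Rightarrow> real \<Rightarrow> int" where
  "dyad k x = \<lfloor>x * 2 powr k\<rfloor>"

definition cell :: "int \<Rightarrow> int \<Rightarrow> real set" where
  "cell k j = {j * 2 powr - k..<j * 2 powr - k + 2 powr - k}"

lemma mem_cell_iff: "x \<in> cell k j \<longleftrightarrow> dyad k x = j"
proof -
  have "x \<in> cell k j \<longleftrightarrow> j \<le> x * 2 powr k \<and> x * 2 powr k < j + 1"
    by (simp add: cell_def powr_minus field_simps)
  then show ?thesis by (simp add: dyad_def floor_eq_iff)
qed

lemma dyad_borel [measurable]: "dyad k \<in> borel \<rightarrow>\<^sub>M count_space UNIV"
  unfolding dyad_def[abs_def] by measurable

lemma cell_borel [measurable]: "cell k j \<in> sets borel"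
  by (simp add: cell_def)

lemma emeasure_cell: "emeasure lborel (cell k j) = ennreal (2 powr - k)"
  by (simp add: cell_def)

lemma dyad_parent: "dyad k x = dyad (k + 1) x div 2"
proof -
  have "\<lfloor>x * 2 powr real_of_int (k + 1) / real_of_int 2\<rfloor> = dyad (k + 1) x div 2"
    unfolding dyad_def by (rule floor_divide_real_eq_div) simp
  then show ?thesis by (simp add: dyad_def powr_add)
qed

lemma dyad_ancestor:
  assumes "k \<le> l" "dyad l s = dyad l t"
  shows "dyad k s = dyad k t"
  using assms
proof (induction k rule: int_le_induct)
  case (step i)
  then show ?case using dyad_parent[of "i - 1"] by simp
qed simp

text \<open>The pairs \<open>(s, t)\<close> that lie in a common dyadic interval of generation
  \<open>k\<close>, with \<open>s\<close> in its left and \<open>t\<close> in its right half. For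
  each dyadic interval these form one rectangle.\<close>

definition split_at :: "int \<Rightarrow> (real \<times> real) set" where
  "split_at k = {(s, t). dyad k s = dyad k t \<and> even (dyad (k + 1) s) \<and> odd (dyad (k + 1) t)}"

lemma split_at_borel [measurable]: "split_at k \<in> sets borel"
proof -
  have "{z \<in> space borel. dyad k (fst z) = dyad k (snd z) \<and> even (dyad (k + 1) (fst z))
      \<and> odd (dyad (k + 1) (snd z))} \<in> sets (borel :: (real \<times> real) measure)"
    by measurable
  moreover have "{z \<in> space borel. dyad k (fst z) = dyad k (snd z) \<and> even (dyad (k + 1) (fst z))
      \<and> odd (dyad (k + 1) (snd z))} = split_at k"
    by (auto simp: split_at_def)
  ultimately show ?thesis by (simp only:)
qed

text \<open>A pair is separated at only one generation: its points lie in different intervals of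
  all later generations. This disjointness is what makes the sum over all generations
  harmless.\<close>

lemma split_at_unique:
  assumes "z \<in> split_at k" "z \<in> split_at l"
  shows "k = l"
proof -
  have False if "z \<in> split_at k" "z \<in> split_at l" "k < l" for k l
    using that dyad_ancestor[of "k + 1" l "fst z" "snd z"] by (auto simp: split_at_def)
  then show ?thesis using assms by (meson linorder_neqE)
qed

lemma sum_split_at_le: "(\<integral>\<^sup>+k. indicator (split_at k) z * c k \<partial>count_space UNIV) \<le> c0"
  if "\<And>k. c k \<le> c0" for c :: "int \<Rightarrow> ennreal"
proof (cases "\<exists>k. z \<in> split_at k")
  case True
  then obtain k0 where k0: "z \<in> split_at k0" by auto
  have "(\<integral>\<^sup>+k. indicator (split_at k) z * c k \<partial>count_space UNIV)
      \<le> (\<integral>\<^sup>+k. c0 * indicator {k0} k \<partial>count_space UNIV)"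
  proof (rule nn_integral_mono)
    fix k
    show "indicator (split_at k) z * c k \<le> c0 * indicator {k0} k"
      using split_at_unique[OF _ k0, of k] that[of k] by (cases "z \<in> split_at k") simp_all
  qed
  also have "\<dots> = c0"
    by (subst nn_integral_cmult_indicator) simp_all
  finally show ?thesis .
next
  case False
  then show ?thesis by simp
qed

text \<open>Sums over all generations are integrals with respect to counting measure, so that
  Tonelli's theorem applies to them.\<close>

lemma nn_integral_count_space_swap:
  fixes f :: "int \<Rightarrow> 'a::euclidean_space \<Rightarrow> ennreal"
  assumes "\<And>k. f k \<in> borel_measurable borel"
  shows "(\<integral>\<^sup>+k. (\<integral>\<^sup>+z. f k z \<partial>lborel) \<partial>count_space UNIV) = (\<integral>\<^sup>+z. (\<integral>\<^sup>+k. f k z \<partial>count_space UNIV) \<partial>lborel)"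
proof -
  interpret P: pair_sigma_finite "count_space (UNIV :: int set)" "lborel :: 'a measure"
    by (intro pair_sigma_finite.intro sigma_finite_measure_count_space sigma_finite_lborel)
  have "case_prod f \<in> borel_measurable (count_space UNIV \<Otimes>\<^sub>M lborel)"
    by (rule measurable_pair_measure_countable1) (use assms in auto)
  from P.Fubini'[OF this] show ?thesis by simp
qed

definition cell_avg :: "(real \<Rightarrow> complex) \<Rightarrow> int \<Rightarrow> int \<Rightarrow> complex" where
  "cell_avg f k j = 2 powr k *\<^sub>R (LINT x:cell k j|lborel. f x)"

definition dyadic_avg :: "(real \<Rightarrow> complex) \<Rightarrow> int \<Rightarrow> real \<Rightarrow> complex" where
  "dyadic_avg f k x = cell_avg f k (dyad k x)"

lemma dyadic_avg_borel [measurable]: "dyadic_avg f k \<in> borel_measurable borel"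
proof -
  have "(\<lambda>x. cell_avg f k (dyad k x)) \<in> borel_measurable borel"
    by (rule measurable_compose[OF dyad_borel]) simp
  then show ?thesis by (simp add: dyadic_avg_def[abs_def])
qed

lemma cell_avg_near:
  assumes int: "set_integrable lborel (cell k j) f"
    and near: "\<And>x. x \<in> cell k j \<Longrightarrow> norm (f x - v) \<le> e"
  shows "norm (cell_avg f k j - v) \<le> e"
proof -
  have one: "set_integrable lborel (cell k j) (\<lambda>_. v)" for v :: complex
    by (simp add: set_integrable_def integrable_indicator_iff cell_def)
  have meas: "measure lborel (cell k j) = 2 powr - k" by (simp add: cell_def)
  have const: "(LINT x:cell k j|lborel. c) = 2 powr - k *\<^sub>R c" for c :: "'b::{banach,second_countable_topology}"
    by (subst set_integral_const) (simp_all add: emeasure_cell meas)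
  have "cell_avg f k j - v = 2 powr k *\<^sub>R ((LINT x:cell k j|lborel. f x) - (LINT x:cell k j|lborel. v))"
    by (simp add: cell_avg_def const scaleR_diff_right flip: powr_add)
  also have "(LINT x:cell k j|lborel. f x) - (LINT x:cell k j|lborel. v) = (LINT x:cell k j|lborel. f x - v)"
    by (rule set_integral_diff(2)[symmetric, OF int one])
  also have "norm (2 powr k *\<^sub>R \<dots>) \<le> 2 powr k * (LINT x:cell k j|lborel. norm (f x - v))"
    by (simp add: set_integral_norm_bound[OF set_integral_diff(1)[OF int one]])
  also have "\<dots> \<le> 2 powr k * (LINT x:cell k j|lborel. e)"
  proof (intro mult_left_mono set_integral_mono)
    show "set_integrable lborel (cell k j) (\<lambda>x. norm (f x - v))"
      by (rule set_integrable_norm[OF set_integral_diff(1)[OF int one]])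
    show "set_integrable lborel (cell k j) (\<lambda>_. e)"
      by (simp add: set_integrable_def integrable_indicator_iff cell_def)
  qed (use near in auto)
  also have "\<dots> = e" by (simp add: const flip: powr_add)
  finally show ?thesis .
qed

text \<open>The data of the embedding: \<open>V\<close> controls \<open>g\<close> through the
  comparison of averages over adjacent intervals.\<close>

locale dyadic_gradient =
  fixes g :: "real \<Rightarrow> complex" and V :: "real \<times> real \<Rightarrow> complex"
  assumes g_borel [measurable]: "g \<in> borel_measurable borel"
    and g_weight: "integrable lborel (\<lambda>x. weight x * norm (g x))"
    and V_integrable: "integrable lborel V"
    and adjacent: "\<And>c L. L > 0 \<Longrightarrow>
      norm ((LINT x:{c..<c+L}|lborel. g x) - (LINT x:{c+L..<c+2*L}|lborel. g x)) * L
      \<le> (2 * L) powr (3/2) * (LINT z|lborel. indicator ({c..<c+L} \<times> {c+L..<c+2*L}) z * norm (V z))"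
begin

lemma V_borel [measurable]: "V \<in> borel_measurable borel"
  using V_integrable borel_measurable_integrable by fastforce

lemma adjacent_cells:
  "norm (cell_avg g k j - cell_avg g k (j + 1))
    \<le> 2 powr (3/2 + k/2) * (LINT z|lborel. indicator (cell k j \<times> cell k (j + 1)) z * norm (V z))"
proof -
  define L where "L = 2 powr - real_of_int k"
  define B where "B = (LINT z|lborel. indicator (cell k j \<times> cell k (j + 1)) z * norm (V z))"
  define D where "D = (LINT x:cell k j|lborel. g x) - (LINT x:cell k (j + 1)|lborel. g x)"
  have L: "L > 0" by (simp add: L_def)
  have I: "cell k j = {j * L..<j * L + L}" "cell k (j + 1) = {j * L + L..<j * L + 2 * L}"
    by (simp_all add: cell_def L_def algebra_simps)
  have *: "norm D * L \<le> (2 * L) powr (3/2) * B"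
    using adjacent[OF L, of "j * L"] unfolding D_def B_def I by simp
  have "norm (cell_avg g k j - cell_avg g k (j + 1)) = 2 powr k * norm D"
    by (simp add: cell_avg_def D_def flip: scaleR_diff_right)
  also have "\<dots> = 2 powr (2 * k) * (norm D * L)"
    by (simp add: L_def mult.left_commute mult.commute[of "norm D"] flip: powr_add mult.assoc)
  also have "\<dots> \<le> 2 powr (2 * k) * ((2 * L) powr (3/2) * B)"
    using * by (intro mult_left_mono) auto
  also have "(2 * L) powr (3/2) = 2 powr (3/2 - 3/2 * k)"
  proof -
    have "2 * L = 2 powr (1 - k)" by (simp add: L_def powr_diff powr_minus divide_inverse)
    moreover have "(1 - real_of_int k) * (3/2) = 3/2 - 3/2 * k" by (simp add: field_simps)
    ultimately show ?thesis by (simp only: powr_powr of_int_diff of_int_1)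
  qed
  also have "2 powr (2 * k) * (2 powr (3/2 - 3/2 * k) * B) = 2 powr (3/2 + k/2) * B"
    by (simp add: algebra_simps flip: powr_add mult.assoc)
  finally show ?thesis by (simp add: B_def)
qed

definition total :: ennreal where
  "total = (\<integral>\<^sup>+z. norm (V z) \<partial>lborel)"

lemma total_finite: "total < \<infinity>"
  using V_integrable by (simp add: total_def integrable_iff_bounded)

lemma total_eq: "total = ennreal (LINT z|lborel. norm (V z))"
  unfolding total_def using V_integrable by (intro nn_integral_eq_integral) auto

text \<open>The mass of \<open>V\<close> on the product of the left and the right half of
  \<open>cell k j\<close>.\<close>

definition split_mass :: "int \<Rightarrow> int \<Rightarrow> ennreal" where
  "split_mass k j = (\<integral>\<^sup>+z. ennreal (norm (V z)) * indicator (split_at k) z * indicator (cell k j) (fst z) \<partial>lborel)"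

lemma cell_g_integrable: "set_integrable lborel (cell k j) g"
  by (rule weighted_set_integrable[OF g_borel g_weight, of _ "j * 2 powr - k" "j * 2 powr - k + 2 powr - k"])
    (auto simp: cell_def)

lemma cell_halves:
  "cell k j = cell (k + 1) (2 * j) \<union> cell (k + 1) (2 * j + 1)"
  "cell (k + 1) (2 * j) \<inter> cell (k + 1) (2 * j + 1) = {}"
proof -
  have "dyad k x = j \<longleftrightarrow> dyad (k + 1) x = 2 * j \<or> dyad (k + 1) x = 2 * j + 1" for x
    unfolding dyad_parent[of k x] by presburger
  then show "cell k j = cell (k + 1) (2 * j) \<union> cell (k + 1) (2 * j + 1)"
    by (auto simp: mem_cell_iff)
qed (auto simp: mem_cell_iff)

lemma cell_avg_halves:
  "cell_avg g k j = (cell_avg g (k + 1) (2 * j) + cell_avg g (k + 1) (2 * j + 1)) / 2"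
proof -
  have "(LINT x:cell k j|lborel. g x)
      = (LINT x:cell (k + 1) (2 * j)|lborel. g x) + (LINT x:cell (k + 1) (2 * j + 1)|lborel. g x)"
    unfolding cell_halves(1)[of k j]
    by (rule set_integral_Un[OF cell_halves(2) cell_g_integrable cell_g_integrable])
  then show ?thesis
    by (simp add: cell_avg_def scaleR_conv_of_real powr_add algebra_simps)
qed

text \<open>The average over an interval is the mean of those over its halves, so each of the
  latter differs from it by half their difference, to which the estimate for adjacent intervals
  applies. The factor is \<open>2\<^sup>3\<^sup>/\<^sup>2
  2\<^sup>(\<^sup>k\<^sup>+\<^sup>1\<^sup>)\<^sup>/\<^sup>2 / 2 = 2
  2\<^sup>k\<^sup>/\<^sup>2\<close>.\<close>

lemma children_close:
  assumes "i = 2 * j \<or> i = 2 * j + 1"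
  shows "ennreal (norm (cell_avg g (k + 1) i - cell_avg g k j)) \<le> ennreal (2 * 2 powr (k/2)) * split_mass k j"
proof -
  let ?l = "cell_avg g (k + 1) (2 * j)" and ?r = "cell_avg g (k + 1) (2 * j + 1)"
  let ?R = "cell (k + 1) (2 * j) \<times> cell (k + 1) (2 * j + 1)"
  define B where "B = (LINT z|lborel. indicator ?R z * norm (V z))"
  have R: "?R \<in> sets borel" by (simp add: borel_Times)
  have "integrable lborel (\<lambda>z. indicat_real ?R z *\<^sub>R norm (V z))"
    by (intro integrable_mult_indicator) (use V_integrable R in auto)
  then have "ennreal B = (\<integral>\<^sup>+z. ennreal (indicator ?R z * norm (V z)) \<partial>lborel)"
    unfolding B_def by (intro nn_integral_eq_integral[symmetric]) auto
  also have "\<dots> \<le> split_mass k j"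
    unfolding split_mass_def
  proof (rule nn_integral_mono)
    fix z
    have "z \<in> split_at k \<and> fst z \<in> cell k j" if "z \<in> ?R"
      using that by (auto simp: split_at_def mem_cell_iff dyad_parent[of k])
    then show "ennreal (indicator ?R z * norm (V z))
        \<le> ennreal (norm (V z)) * indicator (split_at k) z * indicator (cell k j) (fst z)"
      by (cases "z \<in> ?R") auto
  qed
  finally have B: "ennreal B \<le> split_mass k j" .
  have avg: "cell_avg g k j = (?l + ?r) / 2" by (rule cell_avg_halves)
  have "cell_avg g (k + 1) i - cell_avg g k j = (?l - ?r) / 2
      \<or> cell_avg g (k + 1) i - cell_avg g k j = - ((?l - ?r) / 2)"
    using assms unfolding avg by (auto simp: field_simps)
  then have "norm (cell_avg g (k + 1) i - cell_avg g k j) = norm (?l - ?r) / 2"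
    by (elim disjE) (simp_all only: norm_minus_cancel norm_divide norm_numeral)
  also have "\<dots> \<le> 2 powr (3/2 + (k + 1)/2) * B / 2"
    using adjacent_cells[of "k + 1" "2 * j"] by (simp add: B_def)
  also have "\<dots> = 2 * 2 powr (k/2) * B"
  proof -
    have "2 powr (3/2 + (real_of_int k + 1)/2) = 2 powr (2 + k/2)" by (simp add: field_simps)
    also have "\<dots> = 4 * 2 powr (k/2)" by (simp add: powr_add)
    finally show ?thesis by simp
  qed
  finally have "ennreal (norm (cell_avg g (k + 1) i - cell_avg g k j)) \<le> ennreal (2 * 2 powr (k/2) * B)"
    by (rule ennreal_leI)
  also have "\<dots> = ennreal (2 * 2 powr (k/2)) * ennreal B"
    by (rule ennreal_mult') simp
  also have "\<dots> \<le> ennreal (2 * 2 powr (k/2)) * split_mass k j"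
    by (rule mult_left_mono[OF B]) simp
  finally show ?thesis .
qed

text \<open>An upper bound for the total variation of \<open>k \<mapsto> dyadic_avg g k x\<close>
  over all generations.\<close>

definition variation :: "real \<Rightarrow> ennreal" where
  "variation x = (\<integral>\<^sup>+k. ennreal (2 * 2 powr (real_of_int k/2)) * split_mass k (dyad k x) \<partial>count_space UNIV)"

lemma dyadic_step:
  "ennreal (norm (dyadic_avg g (k + 1) x - dyadic_avg g k x))
    \<le> ennreal (2 * 2 powr (k/2)) * split_mass k (dyad k x)"
proof -
  have "dyad (k + 1) x = 2 * dyad k x \<or> dyad (k + 1) x = 2 * dyad k x + 1"
    unfolding dyad_parent[of k x] by presburger
  then show ?thesis unfolding dyadic_avg_def by (rule children_close)
qed

lemma sum_steps_le_variation:
  assumes "finite K"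
  shows "ennreal (\<Sum>k\<in>K. norm (dyadic_avg g (k + 1) x - dyadic_avg g k x)) \<le> variation x"
proof -
  let ?D = "\<lambda>k. ennreal (2 * 2 powr (real_of_int k/2)) * split_mass k (dyad k x)"
  have "ennreal (\<Sum>k\<in>K. norm (dyadic_avg g (k + 1) x - dyadic_avg g k x))
      = (\<Sum>k\<in>K. ennreal (norm (dyadic_avg g (k + 1) x - dyadic_avg g k x)))"
    by (rule sum_ennreal[symmetric]) simp
  also have "\<dots> \<le> (\<Sum>k\<in>K. ?D k)" by (intro sum_mono dyadic_step)
  also have "\<dots> = (\<integral>\<^sup>+k. ?D k \<partial>count_space K)"
    by (rule nn_integral_count_space_finite[OF assms, symmetric])
  also have "\<dots> = (\<integral>\<^sup>+k. ?D k * indicator K k \<partial>count_space UNIV)"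
    by (simp add: nn_integral_count_space_indicator)
  also have "\<dots> \<le> variation x"
    unfolding variation_def by (rule nn_integral_mono) (simp add: indicator_def)
  finally show ?thesis .
qed

lemma dyadic_diff_le_variation:
  assumes "l \<le> m"
  shows "ennreal (norm (dyadic_avg g m x - dyadic_avg g l x)) \<le> variation x"
proof -
  have "norm (dyadic_avg g m x - dyadic_avg g l x)
      \<le> (\<Sum>k\<in>{l..<m}. norm (dyadic_avg g (k + 1) x - dyadic_avg g k x))"
    using assms
  proof (induction m rule: int_ge_induct)
    case (step i)
    have "{l..<i + 1} = insert i {l..<i}" using step(1) by auto
    then show ?case
      using step norm_triangle_ineq[of "dyadic_avg g (i + 1) x - dyadic_avg g i x" "dyadic_avg g i x - dyadic_avg g l x"]
      by simp
  qed simp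
  then show ?thesis
    by (rule order_trans[OF ennreal_leI sum_steps_le_variation]) simp
qed

lemma sum_split_mass_le: "(\<integral>\<^sup>+k. split_mass k (dyad k x) \<partial>count_space UNIV) \<le> total"
proof -
  have "(\<integral>\<^sup>+k. split_mass k (dyad k x) \<partial>count_space UNIV) = (\<integral>\<^sup>+z. (\<integral>\<^sup>+k. ennreal (norm (V z)) *
      indicator (split_at k) z * indicator (cell k (dyad k x)) (fst z) \<partial>count_space UNIV) \<partial>lborel)"
    unfolding split_mass_def by (rule nn_integral_count_space_swap) measurable
  also have "\<dots> \<le> total"
    unfolding total_def
  proof (rule nn_integral_mono)
    fix z
    have "(\<integral>\<^sup>+k. indicator (split_at k) z * (ennreal (norm (V z)) * indicator (cell k (dyad k x)) (fst z)) \<partial>count_space UNIV)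
        \<le> norm (V z)"
      by (rule sum_split_at_le) (simp add: indicator_def)
    then show "(\<integral>\<^sup>+k. ennreal (norm (V z)) * indicator (split_at k) z * indicator (cell k (dyad k x)) (fst z) \<partial>count_space UNIV)
        \<le> norm (V z)"
      by (simp add: mult_ac)
  qed
  finally show ?thesis .
qed

lemma split_mass_borel [measurable]: "(\<lambda>x. split_mass k (dyad k x)) \<in> borel_measurable borel"
  by (rule measurable_compose[OF dyad_borel]) simp

text \<open>The factor \<open>2\<^sup>k\<close> compensates the length of the cells: every cell
  contributes its mass exactly once.\<close>

lemma integral_split_mass:
  "(\<integral>\<^sup>+x. ennreal (2 powr k) * split_mass k (dyad k x) \<partial>lborel)
    = (\<integral>\<^sup>+z. ennreal (norm (V z)) * indicator (split_at k) z \<partial>lborel)"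
proof -
  let ?f = "\<lambda>x z. ennreal (norm (V z)) * indicator (split_at k) z * indicator (cell k (dyad k x)) (fst z)"

  have cell: "indicator (cell k (dyad k x)) s = (if dyad k s = dyad k x then 1 else 0 :: ennreal)" for x s
    by (simp add: indicator_def mem_cell_iff)
  have [measurable]: "case_prod ?f \<in> borel_measurable (lborel \<Otimes>\<^sub>M lborel)"
    unfolding cell by measurable
  have "(\<integral>\<^sup>+x. split_mass k (dyad k x) \<partial>lborel) = (\<integral>\<^sup>+z. (\<integral>\<^sup>+x. ?f x z \<partial>lborel) \<partial>lborel)"
    unfolding split_mass_def by (rule lborel_pair.Fubini'[symmetric]) measurable
  also have "\<dots> = (\<integral>\<^sup>+z. ennreal (norm (V z)) * indicator (split_at k) z * ennreal (2 powr - k) \<partial>lborel)"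
  proof (rule nn_integral_cong)
    fix z :: "real \<times> real"
    have "(\<integral>\<^sup>+x. ?f x z \<partial>lborel)
        = (\<integral>\<^sup>+x. (ennreal (norm (V z)) * indicator (split_at k) z) * indicator (cell k (dyad k (fst z))) x \<partial>lborel)"
      by (rule nn_integral_cong) (simp add: indicator_def mem_cell_iff)
    also have "\<dots> = ennreal (norm (V z)) * indicator (split_at k) z * ennreal (2 powr - k)"
      by (subst nn_integral_cmult_indicator) (auto simp: emeasure_cell)
    finally show "(\<integral>\<^sup>+x. ?f x z \<partial>lborel) = ennreal (norm (V z)) * indicator (split_at k) z * ennreal (2 powr - k)" .
  qed
  also have "\<dots> = ennreal (2 powr - k) * (\<integral>\<^sup>+z. ennreal (norm (V z)) * indicator (split_at k) z \<partial>lborel)"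
    by (subst nn_integral_cmult[symmetric]) (auto intro!: nn_integral_cong simp: mult_ac)
  finally show ?thesis
    by (subst nn_integral_cmult)
      (auto simp: mult.assoc[symmetric] ennreal_mult'[symmetric] simp flip: powr_add)
qed

lemma variation_borel [measurable]: "variation \<in> borel_measurable borel"
proof -
  have "(\<lambda>(k, x). ennreal (2 * 2 powr (real_of_int k/2)) * split_mass k (dyad k x))
      \<in> borel_measurable (count_space UNIV \<Otimes>\<^sub>M borel)"
    by (rule measurable_pair_measure_countable1) auto
  then have "(\<lambda>(x, k). ennreal (2 * 2 powr (real_of_int k/2)) * split_mass k (dyad k x))
      \<in> borel_measurable (borel \<Otimes>\<^sub>M count_space UNIV)"
    by (subst measurable_pair_swap_iff) (simp add: case_prod_unfold)
  then show ?thesis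
    unfolding variation_def[abs_def]
    by (intro sigma_finite_measure.borel_measurable_nn_integral sigma_finite_measure_count_space) auto
qed

text \<open>By the Cauchy-Schwarz inequality over \<open>k\<close> with the masses as weights, the
  square of the variation is at most \<open>4 (\<Sum>k. m\<^sub>k(x)) (\<Sum>k. 2\<^sup>k
  m\<^sub>k(x))\<close>, where \<open>m\<^sub>k(x)\<close> is the mass belonging to the cell of
  \<open>x\<close>. The first sum is at most the norm of \<open>V\<close> for every
  \<open>x\<close>, the second one after integration over \<open>x\<close>, both by the
  disjointness of the rectangles.\<close>

lemma variation_L2: "(\<integral>\<^sup>+x. (variation x)\<^sup>2 \<partial>lborel) \<le> (2 * total)\<^sup>2"
proof -
  let ?C = "count_space (UNIV :: int set)"
  have pointwise: "(variation x)\<^sup>2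
      \<le> 4 * total * (\<integral>\<^sup>+k. ennreal (2 powr real_of_int k) * split_mass k (dyad k x) \<partial>?C)" for x
  proof -
    \<comment> \<open>The masses become the density of a measure on the set of
      generations.\<close>
    let ?M = "density ?C (\<lambda>k. split_mass k (dyad k x))"
    have dens: "(\<integral>\<^sup>+k. f k \<partial>?M) = (\<integral>\<^sup>+k. f k * split_mass k (dyad k x) \<partial>?C)" for f
      by (subst nn_integral_density) (auto simp: mult.commute)
    have "variation x = (\<integral>\<^sup>+k. ennreal (2 * 2 powr (real_of_int k/2)) * 1 \<partial>?M)"
      by (simp add: dens variation_def)
    then have "(variation x)\<^sup>2 \<le> (\<integral>\<^sup>+k. (ennreal (2 * 2 powr (real_of_int k/2)))\<^sup>2 \<partial>?M) * (\<integral>\<^sup>+k. 1\<^sup>2 \<partial>?M)"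
      by (simp only:) (rule Cauchy_Schwarz_nn_integral; simp)
    also have "(\<integral>\<^sup>+k. 1\<^sup>2 \<partial>?M) = (\<integral>\<^sup>+k. split_mass k (dyad k x) \<partial>?C)"
      using dens[of "\<lambda>_. 1"] by simp
    also have "(\<integral>\<^sup>+k. (ennreal (2 * 2 powr (real_of_int k/2)))\<^sup>2 \<partial>?M)
        = (\<integral>\<^sup>+k. 4 * (ennreal (2 powr real_of_int k) * split_mass k (dyad k x)) \<partial>?C)"
      unfolding dens
    proof (rule nn_integral_cong)
      fix k :: int
      have "(ennreal (2 * 2 powr (real_of_int k/2)))\<^sup>2 = ennreal ((2 * 2 powr (real_of_int k/2))\<^sup>2)"
        by (rule ennreal_power) simp
      also have "(2 * 2 powr (real_of_int k/2))\<^sup>2 = 4 * 2 powr real_of_int k"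
        by (simp add: power_mult_distrib power2_eq_square flip: powr_add)
      also have "ennreal (4 * 2 powr real_of_int k) = 4 * ennreal (2 powr real_of_int k)"
        by (simp add: ennreal_mult')
      finally show "(ennreal (2 * 2 powr (real_of_int k/2)))\<^sup>2 * split_mass k (dyad k x)
          = 4 * (ennreal (2 powr real_of_int k) * split_mass k (dyad k x))" by (simp add: mult.assoc)
    qed
    also have "\<dots> = 4 * (\<integral>\<^sup>+k. ennreal (2 powr real_of_int k) * split_mass k (dyad k x) \<partial>?C)"
      by (rule nn_integral_cmult) simp
    finally have "(variation x)\<^sup>2 \<le> 4 * (\<integral>\<^sup>+k. ennreal (2 powr real_of_int k) * split_mass k (dyad k x) \<partial>?C)
        * (\<integral>\<^sup>+k. split_mass k (dyad k x) \<partial>?C)" .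
    also have "\<dots> \<le> 4 * (\<integral>\<^sup>+k. ennreal (2 powr real_of_int k) * split_mass k (dyad k x) \<partial>?C) * total"
      by (rule mult_left_mono[OF sum_split_mass_le]) simp
    finally show ?thesis by (simp add: mult_ac)
  qed
  have meas: "(\<lambda>x. ennreal (2 powr real_of_int k) * split_mass k (dyad k x)) \<in> borel_measurable borel" for k
    by measurable
  have "(\<integral>\<^sup>+x. (variation x)\<^sup>2 \<partial>lborel)
      \<le> (\<integral>\<^sup>+x. 4 * total * (\<integral>\<^sup>+k. ennreal (2 powr real_of_int k) * split_mass k (dyad k x) \<partial>?C) \<partial>lborel)"
    by (rule nn_integral_mono[OF pointwise])
  also have "\<dots> = 4 * total * (\<integral>\<^sup>+x. (\<integral>\<^sup>+k. ennreal (2 powr real_of_int k) * split_mass k (dyad k x) \<partial>?C) \<partial>lborel)"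
  proof (rule nn_integral_cmult)
    have "(\<lambda>(k, x). ennreal (2 powr real_of_int k) * split_mass k (dyad k x))
        \<in> borel_measurable (?C \<Otimes>\<^sub>M borel)"
      by (rule measurable_pair_measure_countable1) auto
    then have "(\<lambda>(x, k). ennreal (2 powr real_of_int k) * split_mass k (dyad k x))
        \<in> borel_measurable (borel \<Otimes>\<^sub>M ?C)"
      by (subst measurable_pair_swap_iff) (simp add: case_prod_unfold)
    then have "(\<lambda>x. \<integral>\<^sup>+k. ennreal (2 powr real_of_int k) * split_mass k (dyad k x) \<partial>?C) \<in> borel_measurable borel"
      by (intro sigma_finite_measure.borel_measurable_nn_integral sigma_finite_measure_count_space) auto
    then show "(\<lambda>x. \<integral>\<^sup>+k. ennreal (2 powr real_of_int k) * split_mass k (dyad k x) \<partial>?C) \<in> borel_measurable lborel"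
      by simp
  qed
  also have "(\<integral>\<^sup>+x. (\<integral>\<^sup>+k. ennreal (2 powr real_of_int k) * split_mass k (dyad k x) \<partial>?C) \<partial>lborel)
      = (\<integral>\<^sup>+k. (\<integral>\<^sup>+z. ennreal (norm (V z)) * indicator (split_at k) z \<partial>lborel) \<partial>?C)"
    by (subst nn_integral_count_space_swap[symmetric, OF meas]) (simp add: integral_split_mass)
  also have "\<dots> = (\<integral>\<^sup>+z. (\<integral>\<^sup>+k. ennreal (norm (V z)) * indicator (split_at k) z \<partial>?C) \<partial>lborel)"
    by (rule nn_integral_count_space_swap) measurable
  also have "\<dots> \<le> total"
    unfolding total_def
  proof (rule nn_integral_mono)
    fix z
    have "(\<integral>\<^sup>+k. indicator (split_at k) z * ennreal (norm (V z)) \<partial>?C) \<le> norm (V z)"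
      by (rule sum_split_at_le) simp
    then show "(\<integral>\<^sup>+k. ennreal (norm (V z)) * indicator (split_at k) z \<partial>?C) \<le> norm (V z)"
      by (simp add: mult.commute)
  qed
  finally have "(\<integral>\<^sup>+x. (variation x)\<^sup>2 \<partial>lborel) \<le> 4 * total * total"
    by (simp add: mult_left_mono order_trans)
  then show ?thesis by (simp add: power2_eq_square mult_ac)
qed

end


section \<open>Limits of the dyadic averages\<close>

lemma powr_minus_half_nat: "2 powr (c + real_of_int (- int n) / 2) = 2 powr c * (2 powr (- 1/2)) ^ n"
proof -
  have "(2 powr (- 1/2)) ^ n = 2 powr (- 1/2 * real n)"
    by (simp add: powr_realpow[symmetric] powr_powr)
  then show ?thesis by (simp flip: powr_add)
qed

context dyadic_gradient
begin

lemma adjacent_cells_total: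
  "norm (cell_avg g k j - cell_avg g k (j + 1)) \<le> 2 powr (3/2 + k/2) * enn2real total"
proof -
  let ?R = "cell k j \<times> cell k (j + 1)"
  have R: "?R \<in> sets borel" by (simp add: borel_Times)
  have "integrable lborel (\<lambda>z. indicat_real ?R z *\<^sub>R norm (V z))"
    by (intro integrable_mult_indicator) (use V_integrable R in auto)
  then have "(LINT z|lborel. indicator ?R z * norm (V z)) \<le> (LINT z|lborel. norm (V z))"
    using V_integrable by (intro integral_mono) (auto simp: indicator_def)
  also have "\<dots> = enn2real total" by (simp add: total_eq)
  finally have "2 powr (3/2 + k/2) * (LINT z|lborel. indicator ?R z * norm (V z)) \<le> 2 powr (3/2 + k/2) * enn2real total"
    by (rule mult_left_mono) simp
  then show ?thesis using adjacent_cells[of k j] by linarith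
qed

text \<open>Every point eventually lies in the long interval with index 0 or \<open>-1\<close>.
  The averages over the former form a Cauchy sequence and those over the latter approach them,
  because the comparison of neighbours at generation \<open>-n\<close> gains the factor
  \<open>2\<^sup>-\<^sup>n\<^sup>/\<^sup>2\<close>. The second point matters since dyadic
  intervals never cross the origin: without it the two half-lines could have different
  constants.\<close>

lemma averages_at_minus_infinity:
  obtains C where "\<And>x. (\<lambda>n. dyadic_avg g (- int n) x) \<longlonglongrightarrow> C"
proof -
  define A0 where "A0 n = cell_avg g (- int n) 0" for n
  define q :: real where "q = 2 powr (- 1/2)"
  have q: "0 < q" "q < 1" by (auto simp: q_def powr_less_one)
  define K where "K = 2 powr (3/2) * enn2real total"
  have close: "norm (cell_avg g (- int n) j - cell_avg g (- int n) (j + 1)) \<le> K * q ^ n" for n j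
    using adjacent_cells_total[of "- int n" j] unfolding powr_minus_half_nat by (simp add: K_def q_def mult_ac)
  have step: "norm (A0 (Suc n) - A0 n) \<le> K * q ^ n" for n
  proof -
    have k: "- int (Suc n) + 1 = - int n" by simp
    have "A0 (Suc n) - A0 n = - ((cell_avg g (- int n) 0 - cell_avg g (- int n) 1) / 2)"
      unfolding A0_def cell_avg_halves[of "- int (Suc n)"] k by (simp add: field_simps)
    then have "norm (A0 (Suc n) - A0 n) = norm (cell_avg g (- int n) 0 - cell_avg g (- int n) (0 + 1)) / 2"
      by (simp add: norm_divide)
    also have "\<dots> \<le> norm (cell_avg g (- int n) 0 - cell_avg g (- int n) (0 + 1))" by simp
    also have "\<dots> \<le> K * q ^ n" by (rule close)
    finally show ?thesis .
  qed
  have "summable (\<lambda>n. A0 (Suc n) - A0 n)"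
    by (rule summable_comparison_test'[OF summable_mult[OF summable_geometric]])
      (use step q in auto)
  then have "convergent (\<lambda>n. \<Sum>i<n. A0 (Suc i) - A0 i)"
    by (simp add: summable_iff_convergent)
  then have "convergent (\<lambda>n. A0 n - A0 0)" by (simp add: sum_lessThan_telescope)
  then obtain C0 where "(\<lambda>n. A0 n - A0 0) \<longlonglongrightarrow> C0" by (auto simp: convergent_def)
  from tendsto_add[OF this tendsto_const[of "A0 0"]]
  have C: "A0 \<longlonglongrightarrow> C0 + A0 0" by simp
  let ?C = "C0 + A0 0"
  have lim: "(\<lambda>n. norm (A0 n - ?C) + K * q ^ n) \<longlonglongrightarrow> 0"
  proof -
    have "(\<lambda>n. norm (A0 n - ?C) + K * q ^ n) \<longlonglongrightarrow> norm (?C - ?C) + K * 0"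
      by (intro tendsto_intros C LIMSEQ_realpow_zero) (use q in auto)
    then show ?thesis by simp
  qed
  have "(\<lambda>n. dyadic_avg g (- int n) x) \<longlonglongrightarrow> ?C" for x
  proof -
    have "(\<lambda>n. dyadic_avg g (- int n) x - ?C) \<longlonglongrightarrow> 0"
    proof (rule Lim_null_comparison[OF _ lim])
      obtain N where N: "\<bar>x\<bar> < 2 ^ N" using real_arch_pow[of 2 "\<bar>x\<bar>"] by auto
      show "\<forall>\<^sub>F n in sequentially. norm (dyadic_avg g (- int n) x - ?C) \<le> norm (A0 n - ?C) + K * q ^ n"
        using eventually_ge_at_top[of N]
      proof eventually_elim
        case (elim n)
        have "(2::real) ^ N \<le> 2 ^ n" using elim by (intro power_increasing) auto
        then have x: "\<bar>x\<bar> < 2 ^ n" using N by linarith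
        have "2 powr real_of_int (- int n) = 1 / 2 ^ n" by (simp add: powr_minus powr_realpow divide_inverse)
        then have "dyad (- int n) x = \<lfloor>x / 2 ^ n\<rfloor>" by (simp add: dyad_def)
        moreover have "- 1 \<le> x / 2 ^ n" "x / 2 ^ n < 1" using x by (auto simp: field_simps abs_less_iff)
        ultimately have "dyad (- int n) x = 0 \<or> dyad (- int n) x = - 1" by linarith
        then show ?case
        proof
          assume "dyad (- int n) x = 0"
          then show ?thesis using q by (simp add: dyadic_avg_def A0_def K_def)
        next
          assume d: "dyad (- int n) x = - 1"
          have "norm (cell_avg g (- int n) (- 1) - ?C)
              \<le> norm (cell_avg g (- int n) (- 1) - cell_avg g (- int n) (- 1 + 1)) + norm (A0 n - ?C)"
            using dist_triangle[of "cell_avg g (- int n) (- 1)" ?C "A0 n"] by (simp add: dist_norm A0_def)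
          also have "\<dots> \<le> K * q ^ n + norm (A0 n - ?C)" by (intro add_right_mono close)
          finally show ?thesis by (simp add: dyadic_avg_def d)
        qed
      qed
    qed
    then show ?thesis using LIM_zero_iff by blast
  qed
  then show thesis by (rule that)
qed

lemma averages_converge:
  assumes "variation x < \<infinity>"
  shows "convergent (\<lambda>n. dyadic_avg g (int n) x)"
proof -
  let ?E = "\<lambda>n. dyadic_avg g (int n) x"
  have "(\<Sum>i<n. norm (?E (Suc i) - ?E i)) \<le> enn2real (variation x)" for n
  proof -
    have "(\<Sum>i<n. norm (?E (Suc i) - ?E i)) = (\<Sum>k\<in>int ` {..<n}. norm (dyadic_avg g (k + 1) x - dyadic_avg g k x))"
      by (subst sum.reindex) (auto simp: add.commute)
    then have "ennreal (\<Sum>i<n. norm (?E (Suc i) - ?E i)) \<le> variation x"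
      using sum_steps_le_variation[of "int ` {..<n}" x] by simp
    then show ?thesis using assms by (cases "variation x") (auto simp: sum_nonneg)
  qed
  then have "summable (\<lambda>i. norm (?E (Suc i) - ?E i))"
    by (intro summableI_nonneg_bounded) auto
  then have "convergent (\<lambda>n. \<Sum>i<n. ?E (Suc i) - ?E i)"
    using summable_norm_cancel by (simp add: summable_iff_convergent)
  then have "convergent (\<lambda>n. ?E n - ?E 0)"
    by (subst (asm) sum_lessThan_telescope)
  then obtain l where "(\<lambda>n. ?E n - ?E 0) \<longlonglongrightarrow> l" by (auto simp: convergent_def)
  from tendsto_add[OF this tendsto_const[of "?E 0"]] show ?thesis by (auto simp: convergent_def)
qed

end

lemma dyad_close:
  assumes "dyad k x = dyad k y"
  shows "\<bar>x - y\<bar> < 2 powr - k"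
proof -
  have "x \<in> cell k (dyad k y)" "y \<in> cell k (dyad k y)" using assms by (auto simp: mem_cell_iff)
  then show ?thesis by (auto simp: cell_def)
qed

lemma weight_same_cell:
  assumes "dyad (int n) x = dyad (int n) y"
  shows "weight x \<le> 4 * weight y"
proof -
  have "\<bar>x - y\<bar> < 1"
    using dyad_close[OF assms] powr_mono[of "- real n" 0 2] by simp
  then have "(1 + \<bar>y\<bar>)\<^sup>2 \<le> (2 * (1 + \<bar>x\<bar>))\<^sup>2" by (intro power_mono) auto
  also have "\<dots> = 4 * (1 + \<bar>x\<bar>)\<^sup>2" by (simp only: power_mult_distrib) simp
  finally have "(1 + \<bar>y\<bar>)\<^sup>2 \<le> 4 * (1 + \<bar>x\<bar>)\<^sup>2" .
  moreover have "(1 + \<bar>x\<bar>)\<^sup>2 > 0" "(1 + \<bar>y\<bar>)\<^sup>2 > 0" by (simp_all add: add_pos_nonneg)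
  ultimately show ?thesis by (simp add: weight_def divide_simps)
qed

lemma continuous_cell_integrable:
  fixes \<phi> :: "real \<Rightarrow> complex"
  assumes "continuous_on UNIV \<phi>"
  shows "set_integrable lborel (cell k j) \<phi>"
proof -
  have "set_integrable lborel {j * 2 powr - k..j * 2 powr - k + 2 powr - k} \<phi>"
    by (rule borel_integrable_atLeastAtMost') (rule continuous_on_subset[OF assms], simp)
  then show ?thesis
    by (rule set_integrable_subset) (auto simp: cell_def)
qed

lemma dyadic_avg_tendsto:
  fixes \<phi> :: "real \<Rightarrow> complex"
  assumes "continuous_on UNIV \<phi>"
  shows "(\<lambda>n. dyadic_avg \<phi> (int n) y) \<longlonglongrightarrow> \<phi> y"
proof (rule LIMSEQ_I)
  fix e :: real assume "e > 0"
  obtain d where d: "d > 0" "\<And>x. \<bar>x - y\<bar> < d \<Longrightarrow> norm (\<phi> x - \<phi> y) < e / 2"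
    using assms \<open>e > 0\<close> unfolding continuous_on_iff dist_norm real_norm_def
    by (meson UNIV_I half_gt_zero)
  obtain N where N: "(1/2) ^ N < d" using real_arch_pow_inv[OF d(1), of "1/2"] by auto
  have "norm (dyadic_avg \<phi> (int n) y - \<phi> y) < e" if "n \<ge> N" for n
  proof -
    have "2 powr - real_of_int (int n) = (1/2) ^ n"
      by (simp add: powr_minus powr_realpow power_one_over inverse_eq_divide)
    moreover have "(1/2::real) ^ n \<le> (1/2) ^ N" using that by (intro power_decreasing) auto
    ultimately have small: "2 powr - real_of_int (int n) < d" using N by linarith
    have "norm (dyadic_avg \<phi> (int n) y - \<phi> y) \<le> e / 2"
      unfolding dyadic_avg_def
    proof (rule cell_avg_near[OF continuous_cell_integrable[OF assms]])
      fix x assume "x \<in> cell (int n) (dyad (int n) y)"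
      then have "\<bar>x - y\<bar> < 2 powr - real_of_int (int n)"
        using dyad_close[of "int n" x y] by (simp add: mem_cell_iff)
      then show "norm (\<phi> x - \<phi> y) \<le> e / 2" using d(2)[of x] small by simp
    qed
    then show ?thesis using \<open>e > 0\<close> by simp
  qed
  then show "\<exists>no. \<forall>n\<ge>no. norm (dyadic_avg \<phi> (int n) y - \<phi> y) < e" by blast
qed

lemma dyadic_avg_weight_bound:
  fixes \<phi> :: "real \<Rightarrow> complex"
  assumes "continuous_on UNIV \<phi>" and M: "M \<ge> 0" "\<And>x. norm (\<phi> x) \<le> M * weight x"
  shows "norm (dyadic_avg \<phi> (int n) y) \<le> 4 * M * weight y"
proof -
  have "norm (cell_avg \<phi> (int n) (dyad (int n) y) - 0) \<le> 4 * M * weight y"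
  proof (rule cell_avg_near[OF continuous_cell_integrable[OF assms(1)]])
    fix x assume "x \<in> cell (int n) (dyad (int n) y)"
    then have "weight x \<le> 4 * weight y" by (intro weight_same_cell) (simp add: mem_cell_iff)
    then have "M * weight x \<le> M * (4 * weight y)" using M(1) by (rule mult_left_mono)
    then show "norm (\<phi> x - 0) \<le> 4 * M * weight y" using M(2)[of x] by simp
  qed
  then show ?thesis by (simp add: dyadic_avg_def)
qed

lemma dyadic_avg_eq:
  "dyadic_avg f k x = (LINT y|lborel. of_real (2 powr k * indicator (cell k (dyad k x)) y) * f y)"
  unfolding dyadic_avg_def cell_avg_def set_lebesgue_integral_def
  by (subst integral_scaleR_right[symmetric]) (simp add: scaleR_conv_of_real mult_ac)

context dyadic_gradient
begin

text \<open>Averaging has the symmetric kernel \<open>2\<^sup>n\<close> on pairs in a common cell.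
  Integrability on the plane holds because the weight is comparable to a constant on cells of
  length at most 1.\<close>

lemma dyadic_avg_self_adjoint:
  assumes \<phi>: "continuous_on UNIV \<phi>" and M: "M \<ge> 0" "\<And>x. norm (\<phi> x) \<le> M * weight x"
  shows "(LINT x|lborel. dyadic_avg g (int n) x * \<phi> x) = (LINT y|lborel. g y * dyadic_avg \<phi> (int n) y)"
proof -
  let ?k = "int n"
  define Q where "Q x y = of_real (2 powr ?k * indicator (cell ?k (dyad ?k x)) y) * (g y * \<phi> x)" for x y
  have ind: "indicator (cell ?k (dyad ?k x)) y = (if dyad ?k x = dyad ?k y then 1 else 0 :: real)" for x y
    by (simp add: indicator_def mem_cell_iff eq_commute)
  have [measurable]: "\<phi> \<in> borel_measurable borel" by (rule borel_measurable_continuous_onI[OF \<phi>])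
  have Q_borel: "case_prod Q \<in> borel_measurable (lborel \<Otimes>\<^sub>M lborel)"
    unfolding Q_def ind by measurable
  have Q: "integrable (lborel \<Otimes>\<^sub>M lborel) (case_prod Q)"
  proof (rule integrableI_bounded[OF Q_borel])
    have "(\<integral>\<^sup>+z. norm (case_prod Q z) \<partial>(lborel \<Otimes>\<^sub>M lborel)) = (\<integral>\<^sup>+y. (\<integral>\<^sup>+x. norm (Q x y) \<partial>lborel) \<partial>lborel)"
      using lborel_pair.nn_integral_snd[of "\<lambda>z. ennreal (norm (case_prod Q z))"] Q_borel by simp
    also have "\<dots> \<le> (\<integral>\<^sup>+y. ennreal (4 * M * (weight y * norm (g y))) \<partial>lborel)"
    proof (rule nn_integral_mono)
      fix y
      let ?c = "2 powr ?k * (4 * M * (weight y * norm (g y)))"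
      have c: "?c \<ge> 0" using M(1) weight_pos[of y] by simp
      have "(\<integral>\<^sup>+x. norm (Q x y) \<partial>lborel) \<le> (\<integral>\<^sup>+x. ennreal ?c * indicator (cell ?k (dyad ?k y)) x \<partial>lborel)"
      proof (rule nn_integral_mono)
        fix x
        show "ennreal (norm (Q x y)) \<le> ennreal ?c * indicator (cell ?k (dyad ?k y)) x"
        proof (cases "dyad ?k x = dyad ?k y")
          case True
          have "norm (\<phi> x) \<le> M * (4 * weight y)"
            using order_trans[OF M(2)] mult_left_mono[OF weight_same_cell[OF True] M(1)] by blast
          then have "norm (g y) * norm (\<phi> x) \<le> norm (g y) * (M * (4 * weight y))"
            by (rule mult_left_mono) simp
          then have "2 powr ?k * (norm (g y) * norm (\<phi> x)) \<le> 2 powr ?k * (norm (g y) * (M * (4 * weight y)))"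
            by (rule mult_left_mono) simp
          then have "norm (Q x y) \<le> ?c"
            using True by (simp add: Q_def ind norm_mult mult_ac)
          then show ?thesis using True by (simp add: indicator_def mem_cell_iff ennreal_leI)
        qed (simp add: Q_def ind)
      qed
      also have "\<dots> = ennreal ?c * ennreal (2 powr - ?k)"
        by (subst nn_integral_cmult_indicator) (simp_all add: emeasure_cell)
      also have "\<dots> = ennreal (4 * M * (weight y * norm (g y)))"
        using c by (subst ennreal_mult'[symmetric]) (auto simp: powr_minus field_simps)
      finally show "(\<integral>\<^sup>+x. norm (Q x y) \<partial>lborel) \<le> ennreal (4 * M * (weight y * norm (g y)))" .
    qed
    also have "\<dots> < \<infinity>"
    proof -
      have "integrable lborel (\<lambda>y. 4 * M * (weight y * norm (g y)))" using g_weight by simp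
      then have "(\<integral>\<^sup>+y. ennreal (norm (4 * M * (weight y * norm (g y)))) \<partial>lborel) < \<infinity>"
        by (simp only: integrable_iff_bounded)
      moreover have "norm (4 * M * (weight y * norm (g y))) = 4 * M * (weight y * norm (g y))" for y
        using M(1) weight_pos[of y] by simp
      ultimately show ?thesis by (simp only:)
    qed
    finally show "(\<integral>\<^sup>+z. norm (case_prod Q z) \<partial>(lborel \<Otimes>\<^sub>M lborel)) < \<infinity>" .
  qed
  have "(LINT x|lborel. dyadic_avg g ?k x * \<phi> x) = (LINT x|lborel. (LINT y|lborel. Q x y))"
    unfolding dyadic_avg_eq Q_def integral_mult_left_zero[symmetric] mult.assoc ..
  also have "\<dots> = (LINT y|lborel. (LINT x|lborel. Q x y))"
    by (rule lborel_pair.Fubini_integral[OF Q, symmetric])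
  also have "\<dots> = (LINT y|lborel. g y * dyadic_avg \<phi> ?k y)"
    unfolding dyadic_avg_eq Q_def ind integral_mult_right_zero[symmetric]
    by (intro Bochner_Integration.integral_cong) (auto simp: mult_ac eq_commute)
  finally show ?thesis .
qed

text \<open>The limit \<open>f\<close> of the averages minus \<open>C\<close> is dominated by the
  variation, which gives the norm. For the weak identity the averaging is moved to the test
  function, where it converges by continuity; the averages of \<open>g\<close> minus
  \<open>C\<close>, multiplied by the test function, converge under the integral because the
  variation dominates them.\<close>

lemma L2_representative:
  obtains C f where "f \<in> borel_measurable borel"
    "(\<integral>\<^sup>+x. ennreal ((norm (f x))\<^sup>2) \<partial>lborel) \<le> (2 * total)\<^sup>2"
    "\<And>\<phi>. \<phi> \<in> schwartz \<Longrightarrow>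
      (LINT x|lborel. g x * \<phi> x) - C * (LINT x|lborel. \<phi> x) = (LINT x|lborel. f x * \<phi> x)"
proof -
  obtain C where C: "\<And>x. (\<lambda>n. dyadic_avg g (- int n) x) \<longlonglongrightarrow> C"
    using averages_at_minus_infinity by blast
  define f where "f x = lim (\<lambda>n. dyadic_avg g (int n) x) - C" for x
  have f_borel [measurable]: "f \<in> borel_measurable borel"
    unfolding f_def[abs_def] by measurable
  have L2: "(\<integral>\<^sup>+x. (variation x)\<^sup>2 \<partial>lborel) < \<infinity>"
    by (rule order_le_less_trans[OF variation_L2])
      (use total_finite in \<open>simp add: power2_eq_square ennreal_mult_less_top\<close>)
  have "AE x in lborel. (variation x)\<^sup>2 \<noteq> \<infinity>"
    by (rule nn_integral_PInf_AE) (use L2 in auto)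
  then have finite: "AE x in lborel. variation x < \<infinity>"
    by eventually_elim (auto simp: less_top power2_eq_square ennreal_mult_eq_top_iff)
  have close: "ennreal (norm (dyadic_avg g (int n) x - C)) \<le> variation x" for n x
  proof (rule Lim_bounded)
    show "(\<lambda>m. ennreal (norm (dyadic_avg g (int n) x - dyadic_avg g (- int m) x)))
        \<longlonglongrightarrow> ennreal (norm (dyadic_avg g (int n) x - C))"
      by (intro tendsto_ennrealI tendsto_intros C)
    show "\<forall>m\<ge>0. ennreal (norm (dyadic_avg g (int n) x - dyadic_avg g (- int m) x)) \<le> variation x"
      by (auto intro!: dyadic_diff_le_variation)
  qed
  have lim: "(\<lambda>n. dyadic_avg g (int n) x - C) \<longlonglongrightarrow> f x" if "variation x < \<infinity>" for x
    unfolding f_def using averages_converge[OF that] by (intro tendsto_intros) (simp add: convergent_LIMSEQ_iff)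
  have f_le: "ennreal (norm (f x)) \<le> variation x" if "variation x < \<infinity>" for x
    by (rule Lim_bounded[OF tendsto_ennrealI[OF tendsto_norm[OF lim[OF that]]], of 0]) (use close in auto)
  have "(\<integral>\<^sup>+x. ennreal ((norm (f x))\<^sup>2) \<partial>lborel) \<le> (\<integral>\<^sup>+x. (variation x)\<^sup>2 \<partial>lborel)"
  proof (rule nn_integral_mono_AE)
    show "AE x in lborel. ennreal ((norm (f x))\<^sup>2) \<le> (variation x)\<^sup>2"
      using finite
    proof eventually_elim
      case (elim x)
      have "(ennreal (norm (f x)))\<^sup>2 \<le> (variation x)\<^sup>2" by (rule power_mono[OF f_le[OF elim]]) simp
      then show ?case by (simp add: ennreal_power)
    qed
  qed
  also note variation_L2
  finally have f_L2: "(\<integral>\<^sup>+x. ennreal ((norm (f x))\<^sup>2) \<partial>lborel) \<le> (2 * total)\<^sup>2" .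
  define H where "H x = enn2real (variation x)" for x
  have [measurable]: "H \<in> borel_measurable borel" unfolding H_def[abs_def] by measurable
  have H_sq: "integrable lborel (\<lambda>x. (H x)\<^sup>2)"
  proof (rule integrableI_bounded)
    have "(\<integral>\<^sup>+x. ennreal (norm ((H x)\<^sup>2)) \<partial>lborel) \<le> (\<integral>\<^sup>+x. (variation x)\<^sup>2 \<partial>lborel)"
    proof (rule nn_integral_mono)
      fix x
      have "ennreal (H x) \<le> variation x" by (cases "variation x") (auto simp: H_def)
      then have "(ennreal (H x))\<^sup>2 \<le> (variation x)\<^sup>2" by (rule power_mono) simp
      then show "ennreal (norm ((H x)\<^sup>2)) \<le> (variation x)\<^sup>2" by (simp add: ennreal_power H_def)
    qed
    then show "(\<integral>\<^sup>+x. ennreal (norm ((H x)\<^sup>2)) \<partial>lborel) < \<infinity>" using L2 by (rule order_le_less_trans)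
  qed measurable
  have H_le: "norm (dyadic_avg g (int n) x - C) \<le> H x" if "variation x < \<infinity>" for n x
    using close[of n x] that by (cases "variation x") (auto simp: H_def)
  have weak: "(LINT x|lborel. g x * \<phi> x) - C * (LINT x|lborel. \<phi> x) = (LINT x|lborel. f x * \<phi> x)"
    if \<phi>_schwartz: "\<phi> \<in> schwartz" for \<phi>
  proof -
    have \<phi>: "continuous_on UNIV \<phi>" by (rule schwartz_continuous[OF \<phi>_schwartz])
    have [measurable]: "\<phi> \<in> borel_measurable borel" by (rule schwartz_borel[OF \<phi>_schwartz])
    obtain M where M: "M \<ge> 0" "\<And>x. norm (\<phi> x) \<le> M * weight x"
      using schwartz_weight_bound[OF \<phi>_schwartz] by metis
    have \<phi>_int: "integrable lborel \<phi>" by (rule schwartz_integrable[OF \<phi>_schwartz])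
    have \<phi>_sq: "integrable lborel (\<lambda>x. (norm (\<phi> x))\<^sup>2)"
    proof (rule Bochner_Integration.integrable_bound[of _ "\<lambda>x. M * norm (\<phi> x)"])
      show "AE x in lborel. norm ((norm (\<phi> x))\<^sup>2) \<le> norm (M * norm (\<phi> x))"
      proof (rule AE_I2)
        fix x
        have "weight x \<le> 1" by (simp add: weight_def divide_simps add_pos_nonneg one_le_power)
        then have "M * weight x \<le> M * 1" using M(1) by (rule mult_left_mono)
        then have "norm (\<phi> x) \<le> M" using M(2)[of x] by simp
        then have "norm (\<phi> x) * norm (\<phi> x) \<le> M * norm (\<phi> x)" by (rule mult_right_mono) simp
        then show "norm ((norm (\<phi> x))\<^sup>2) \<le> norm (M * norm (\<phi> x))"
          using M(1) by (simp add: power2_eq_square abs_mult)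
      qed
    qed (use \<phi>_int in auto)
    have H\<phi>: "integrable lborel (\<lambda>x. H x * norm (\<phi> x))"
    proof (rule Bochner_Integration.integrable_bound[of _ "\<lambda>x. (H x)\<^sup>2 + (norm (\<phi> x))\<^sup>2"])
      show "integrable lborel (\<lambda>x. (H x)\<^sup>2 + (norm (\<phi> x))\<^sup>2)" using H_sq \<phi>_sq by simp
      show "AE x in lborel. norm (H x * norm (\<phi> x)) \<le> norm ((H x)\<^sup>2 + (norm (\<phi> x))\<^sup>2)"
      proof (rule AE_I2)
        fix x
        have "0 \<le> H x * norm (\<phi> x)" by (simp add: H_def)
        moreover have "2 * (H x * norm (\<phi> x)) \<le> (H x)\<^sup>2 + (norm (\<phi> x))\<^sup>2"
          using sum_squares_bound[of "H x" "norm (\<phi> x)"] by (simp add: mult.assoc)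
        ultimately show "norm (H x * norm (\<phi> x)) \<le> norm ((H x)\<^sup>2 + (norm (\<phi> x))\<^sup>2)" by simp
      qed
    qed measurable
    have dom: "AE x in lborel. norm ((dyadic_avg g (int n) x - C) * \<phi> x) \<le> H x * norm (\<phi> x)" for n
      using finite by eventually_elim (simp add: norm_mult mult_right_mono H_le)
    have int_n: "integrable lborel (\<lambda>x. (dyadic_avg g (int n) x - C) * \<phi> x)" for n
      by (rule Bochner_Integration.integrable_bound[OF H\<phi>])
        (use dom[of n] in \<open>auto simp: H_def elim!: eventually_mono\<close>)
    have lhs: "(\<lambda>n. LINT x|lborel. (dyadic_avg g (int n) x - C) * \<phi> x) \<longlonglongrightarrow> (LINT x|lborel. f x * \<phi> x)"
    proof (rule integral_dominated_convergence[OF _ _ H\<phi> _ dom])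
      show "AE x in lborel. (\<lambda>n. (dyadic_avg g (int n) x - C) * \<phi> x) \<longlonglongrightarrow> f x * \<phi> x"
        using finite by eventually_elim (intro tendsto_intros lim)
    qed measurable
    have split: "(LINT x|lborel. (dyadic_avg g (int n) x - C) * \<phi> x)
        = (LINT y|lborel. g y * dyadic_avg \<phi> (int n) y) - C * (LINT x|lborel. \<phi> x)" for n
    proof -
      have "(LINT y|lborel. g y * dyadic_avg \<phi> (int n) y) = (LINT x|lborel. dyadic_avg g (int n) x * \<phi> x)"
        by (rule dyadic_avg_self_adjoint[OF \<phi> M, symmetric])
      also have "\<dots> = (LINT x|lborel. (dyadic_avg g (int n) x - C) * \<phi> x + C * \<phi> x)"
        by (rule Bochner_Integration.integral_cong) (auto simp: algebra_simps)
      also have "\<dots> = (LINT x|lborel. (dyadic_avg g (int n) x - C) * \<phi> x) + C * (LINT x|lborel. \<phi> x)"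
        using int_n \<phi>_int by simp
      finally show ?thesis by simp
    qed
    have "(\<lambda>n. LINT y|lborel. g y * dyadic_avg \<phi> (int n) y) \<longlonglongrightarrow> (LINT y|lborel. g y * \<phi> y)"
    proof (rule integral_dominated_convergence)
      show "integrable lborel (\<lambda>y. 4 * M * (weight y * norm (g y)))" using g_weight by simp
      show "AE y in lborel. (\<lambda>n. g y * dyadic_avg \<phi> (int n) y) \<longlonglongrightarrow> g y * \<phi> y"
        by (intro AE_I2 tendsto_intros dyadic_avg_tendsto \<phi>)
      show "AE y in lborel. norm (g y * dyadic_avg \<phi> (int n) y) \<le> 4 * M * (weight y * norm (g y))" for n
      proof (rule AE_I2)
        fix y
        have "norm (g y) * norm (dyadic_avg \<phi> (int n) y) \<le> norm (g y) * (4 * M * weight y)"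
          by (intro mult_left_mono dyadic_avg_weight_bound \<phi> M norm_ge_zero)
        then show "norm (g y * dyadic_avg \<phi> (int n) y) \<le> 4 * M * (weight y * norm (g y))"
          by (simp add: norm_mult mult_ac)
      qed
    qed measurable
    then have "(\<lambda>n. LINT x|lborel. (dyadic_avg g (int n) x - C) * \<phi> x)
        \<longlonglongrightarrow> (LINT y|lborel. g y * \<phi> y) - C * (LINT x|lborel. \<phi> x)"
      unfolding split by (intro tendsto_intros)
    from LIMSEQ_unique[OF this lhs] show ?thesis .
  qed
  show thesis by (rule that[OF f_borel f_L2 weak])
qed

end

theorem theorem4p1:
  shows "\<exists>K>0. \<forall>u \<in> tempered_distributions. \<forall>F \<in> L1_od. d_half u = od_distribution F \<longrightarrow>
    (\<exists>C::complex. \<exists>f \<in> L2.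
       (\<lambda>\<phi>\<in>schwartz. u \<phi> - fun_distribution (\<lambda>_. C) \<phi>) = fun_distribution f \<and>
       L2_norm f \<le> K * L1_od_norm F)"
proof (intro exI[of _ "2::real"] conjI ballI impI)
  fix u :: "(real \<Rightarrow> complex) \<Rightarrow> complex" and F
  assume u: "u \<in> tempered_distributions" and F: "F \<in> L1_od" and eq: "d_half u = od_distribution F"
  obtain V where V: "integrable lborel V" and V_norm: "(LINT z|lborel. norm (V z)) \<le> L1_od_norm F"
    and V_swap: "\<And>z. V (prod.swap z) = - V z"
    and diff: "weak_difference u V"
    by (rule d_half_weak_difference[OF u F eq]) (rule that)
  have u_add: "u (\<lambda>x. f x + g x) = u f + u g" if "f \<in> schwartz" "g \<in> schwartz" for f g
    using u that by (simp add: topological_dual_def)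
  obtain g where g: "g \<in> borel_measurable borel" "integrable lborel (\<lambda>x. weight x * norm (g x))"
    and u_eq: "\<And>\<phi>. \<phi> \<in> schwartz \<Longrightarrow> u \<phi> = (LINT x|lborel. g x * \<phi> x)"
    by (rule distribution_eq_function[OF u_add V V_swap diff]) (assumption | rule that)+
  have g_diff: "weak_difference (\<lambda>\<phi>. LINT x|lborel. g x * \<phi> x) V"
    using diff by (simp add: weak_difference_def flip: u_eq)
  interpret dyadic_gradient g V
  proof
    fix c L :: real assume L: "L > 0"
    show "norm ((LINT x:{c..<c+L}|lborel. g x) - (LINT x:{c+L..<c+2*L}|lborel. g x)) * L
      \<le> (2 * L) powr (3/2) * (LINT z|lborel. indicator ({c..<c+L} \<times> {c+L..<c+2*L}) z * norm (V z))"
      by (rule adjacent_interval_estimate[OF g V g_diff L])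
  qed (rule g V)+
  obtain C f where f [measurable]: "f \<in> borel_measurable borel"
    and f_norm: "(\<integral>\<^sup>+x. ennreal ((norm (f x))\<^sup>2) \<partial>lborel) \<le> (2 * total)\<^sup>2"
    and weak: "\<And>\<phi>. \<phi> \<in> schwartz \<Longrightarrow>
      (LINT x|lborel. g x * \<phi> x) - C * (LINT x|lborel. \<phi> x) = (LINT x|lborel. f x * \<phi> x)"
    by (rule L2_representative) (assumption | rule that)+
  let ?N = "LINT z|lborel. norm (V z)"
  have N: "?N \<ge> 0" by simp
  have f_norm': "(\<integral>\<^sup>+x. ennreal ((norm (f x))\<^sup>2) \<partial>lborel) \<le> ennreal ((2 * ?N)\<^sup>2)"
  proof -
    have "2 * total = ennreal (2 * ?N)" using N by (simp add: total_eq ennreal_mult')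
    then have "(2 * total)\<^sup>2 = ennreal ((2 * ?N)\<^sup>2)" using N by (simp only: ennreal_power mult_nonneg_nonneg zero_le_numeral)
    then show ?thesis using f_norm by simp
  qed
  have f_sq: "integrable lborel (\<lambda>x. (norm (f x))\<^sup>2)"
    by (rule integrableI_bounded) (use order_le_less_trans[OF f_norm'] in auto)
  have f_leb: "f \<in> borel_measurable lebesgue" by (rule measurable_completion) simp
  have "f \<in> L2"
    using f_sq f_leb by (simp add: L2_def integrable_completion)
  moreover have "(\<lambda>\<phi>\<in>schwartz. u \<phi> - fun_distribution (\<lambda>_. C) \<phi>) = fun_distribution f"
    unfolding fun_distribution_def
  proof (rule restrict_ext)
    fix \<phi> :: "real \<Rightarrow> complex" assume \<phi>: "\<phi> \<in> schwartz"
    have [measurable]: "\<phi> \<in> borel_measurable borel" by (rule schwartz_borel[OF \<phi>])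
    have "(LINT x|lebesgue. \<phi> x) = (LINT x|lborel. \<phi> x)"
      by (rule integral_completion) simp
    moreover have "(LINT x|lebesgue. f x * \<phi> x) = (LINT x|lborel. f x * \<phi> x)"
      by (rule integral_completion) simp
    ultimately show "u \<phi> - (\<lambda>\<phi>\<in>schwartz. LINT x|lebesgue. C * \<phi> x) \<phi> = (LINT x|lebesgue. f x * \<phi> x)"
      using \<phi> u_eq[OF \<phi>] weak[OF \<phi>] by simp
  qed
  moreover have "L2_norm f \<le> 2 * L1_od_norm F"
  proof -
    have "(LINT x|lebesgue. (norm (f x))\<^sup>2) = (LINT x|lborel. (norm (f x))\<^sup>2)"
      by (rule integral_completion) simp
    also have "\<dots> \<le> (2 * ?N)\<^sup>2"
    proof -
      have "ennreal (LINT x|lborel. (norm (f x))\<^sup>2) = (\<integral>\<^sup>+x. ennreal ((norm (f x))\<^sup>2) \<partial>lborel)"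
        using f_sq by (intro nn_integral_eq_integral[symmetric]) auto
      then have "ennreal (LINT x|lborel. (norm (f x))\<^sup>2) \<le> ennreal ((2 * ?N)\<^sup>2)" using f_norm' by simp
      then show ?thesis by (subst (asm) ennreal_le_iff) auto
    qed
    finally have "L2_norm f \<le> 2 * ?N"
      unfolding L2_norm_def using N by (intro real_le_lsqrt) auto
    then show ?thesis using V_norm by simp
  qed
  ultimately show "\<exists>C. \<exists>f\<in>L2. (\<lambda>\<phi>\<in>schwartz. u \<phi> - fun_distribution (\<lambda>_. C) \<phi>) = fun_distribution f
      \<and> L2_norm f \<le> 2 * L1_od_norm F"
    by blast
qed simp

end
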